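(* (1) In ZFC + CH, the boolean algebra $\mathcal{B}_1$ is isomorphic to the boolean algebra $\mathcal{B}_2$. (2) In ZFC + OCA, $\mathcal{B}_1$ is not isomorphic to $\mathcal{B}_2$.
   Context: Let $Fin$ be the ideal of finite subsets of $\mathbb{N}$, and let $\mathcal{B}_1=(\mathcal{P}(\mathbb{N})/Fin,\cap,\cup,\neg,\mathbf{0},\mathbf{1})$ be the quotient boolean algebra of subsets of $\mathbb{N}$ modulo the equivalence "$A \approx B$ iff the symmetric difference $A\Delta B$ is finite", with operations induced by intersection, union and complementation, $\mathbf{0}=[\emptyset]$, $\mathbf{1}=[\mathbb{N}]$. Let $\mathbb{T}=\{l,r\}^\star$ be the set of finite words over $\{l,r\}$, ordered by the prefix order, and let $I=\{B\subseteq \mathbb{T} : B \text{ has no infinite antichain for the prefix order}\}$, an ideal of $\mathcal{P}(\mathbb{T})$. Let $\mathcal{B}_2=(\mathcal{P}(\mathbb{T})/I,\cap,\cup,\neg,\mathbf{0},\mathbf{1})$ be the quotient boolean algebra modulo "$A\approx_I B$ iff $A\Delta B\in I$", with $\mathbf{0}=[\emptyset]$, $\mathbf{1}=[\mathbb{T}]$. Both are $\omega$-tree-automatic atomless boolean algebras. CH is the Continuum Hypothesis and OCA is the Open Coloring Axiom. *)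

theory Defs
  imports "HOL-Analysis.Analysis" "HOL-Library.Sublist" "HOL-Library.Ramsey"
begin

section \<open>Ideals of sets and equality modulo an ideal\<close>

definition set_ideal :: "'a set set \<Rightarrow> bool" where
  "set_ideal J \<longleftrightarrow>
     {} \<in> J \<and> (\<forall>A\<in>J. \<forall>B. B \<subseteq> A \<longrightarrow> B \<in> J) \<and> (\<forall>A\<in>J. \<forall>B\<in>J. A \<union> B \<in> J)"

definition eq_mod :: "'a set set \<Rightarrow> 'a set \<Rightarrow> 'a set \<Rightarrow> bool" where
  "eq_mod J A B \<longleftrightarrow> sym_diff A B \<in> J"

lemma set_ideal_subset: "set_ideal J \<Longrightarrow> A \<in> J \<Longrightarrow> B \<subseteq> A \<Longrightarrow> B \<in> J"
  by (auto simp: set_ideal_def)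

lemma set_ideal_Un: "set_ideal J \<Longrightarrow> A \<in> J \<Longrightarrow> B \<in> J \<Longrightarrow> A \<union> B \<in> J"
  by (auto simp: set_ideal_def)

lemma equivp_eq_mod:
  assumes J: "set_ideal J"
  shows "equivp (eq_mod J)"
proof (rule equivpI)
  show "reflp (eq_mod J)"
    using J by (auto simp: reflp_def eq_mod_def set_ideal_def)
  show "symp (eq_mod J)"
    by (auto simp: symp_def eq_mod_def Un_commute)
  show "transp (eq_mod J)"
  proof (rule transpI)
    fix A B C
    assume "eq_mod J A B" "eq_mod J B C"
    then have "sym_diff A B \<union> sym_diff B C \<in> J"
      unfolding eq_mod_def by (rule set_ideal_Un[OF J])
    then show "eq_mod J A C"
      unfolding eq_mod_def by (rule set_ideal_subset[OF J]) auto
  qed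
qed

lemma eq_mod_Int:
  assumes J: "set_ideal J" and "eq_mod J A A'" "eq_mod J B B'"
  shows "eq_mod J (A \<inter> B) (A' \<inter> B')"
proof -
  have "sym_diff A A' \<union> sym_diff B B' \<in> J"
    using assms(2,3) unfolding eq_mod_def by (rule set_ideal_Un[OF J])
  then show ?thesis
    unfolding eq_mod_def by (rule set_ideal_subset[OF J]) auto
qed

lemma eq_mod_Compl: "eq_mod J A A' \<Longrightarrow> eq_mod J (- A) (- A')"
proof -
  have "sym_diff (- A) (- A') = sym_diff A A'" by auto
  then show "eq_mod J A A' \<Longrightarrow> eq_mod J (- A) (- A')"
    by (simp only: eq_mod_def)
qed

lemma eq_mod_Un:
  assumes J: "set_ideal J" and "eq_mod J A A'" "eq_mod J B B'"
  shows "eq_mod J (A \<union> B) (A' \<union> B')"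
proof -
  have "sym_diff A A' \<union> sym_diff B B' \<in> J"
    using assms(2,3) unfolding eq_mod_def by (rule set_ideal_Un[OF J])
  then show ?thesis
    unfolding eq_mod_def by (rule set_ideal_subset[OF J]) auto
qed

lemma eq_mod_Diff:
  assumes J: "set_ideal J" and "eq_mod J A A'" "eq_mod J B B'"
  shows "eq_mod J (A - B) (A' - B')"
  using eq_mod_Int[OF J assms(2) eq_mod_Compl[OF assms(3)]] by (simp add: Diff_eq)

lemma Diff_in_ideal_cong:
  assumes J: "set_ideal J" and A: "eq_mod J A A'" and B: "eq_mod J B B'"
  shows "A - B \<in> J \<longleftrightarrow> A' - B' \<in> J"
proof -
  have *: "C' \<in> J" if "eq_mod J C C'" "C \<in> J" for C C'
  proof -
    have "C \<union> sym_diff C C' \<in> J"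
      using that(2,1) unfolding eq_mod_def by (rule set_ideal_Un[OF J])
    then show ?thesis by (rule set_ideal_subset[OF J]) auto
  qed
  have D: "eq_mod J (A - B) (A' - B')"
    by (rule eq_mod_Diff[OF J A B])
  have D': "eq_mod J (A' - B') (A - B)"
    by (rule equivp_symp[OF equivp_eq_mod[OF J] D])
  show ?thesis
    using *[OF D] *[OF D'] by (rule iffI)
qed

lemma Diff_in_ideal_trans:
  assumes J: "set_ideal J" and "A - B \<in> J" "B - C \<in> J"
  shows "A - C \<in> J"
  by (rule set_ideal_subset[OF J set_ideal_Un[OF J assms(2,3)]]) auto

lemma Diff_in_ideal_antisym:
  assumes "set_ideal J" and "A - B \<in> J" "B - A \<in> J"
  shows "eq_mod J A B"
  unfolding eq_mod_def by (rule set_ideal_Un[OF assms])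


section \<open>The algebra of subsets of the natural numbers modulo finite sets\<close>

definition Fin :: "nat set set" where
  "Fin = {A. finite A}"

lemma set_ideal_Fin: "set_ideal Fin"
  by (auto simp: set_ideal_def Fin_def intro: finite_subset)

quotient_type B1 = "nat set" / "eq_mod Fin"
  by (rule equivp_eq_mod[OF set_ideal_Fin])

instantiation B1 :: boolean_algebra
begin

lift_definition inf_B1 :: "B1 \<Rightarrow> B1 \<Rightarrow> B1" is "(\<inter>)"
  by (rule eq_mod_Int[OF set_ideal_Fin])

lift_definition sup_B1 :: "B1 \<Rightarrow> B1 \<Rightarrow> B1" is "(\<union>)"
  by (rule eq_mod_Un[OF set_ideal_Fin])

lift_definition uminus_B1 :: "B1 \<Rightarrow> B1" is "\<lambda>A. - A"
  by (rule eq_mod_Compl)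

lift_definition minus_B1 :: "B1 \<Rightarrow> B1 \<Rightarrow> B1" is "\<lambda>A B. A - B"
  by (rule eq_mod_Diff[OF set_ideal_Fin])

lift_definition bot_B1 :: B1 is "{}" .

lift_definition top_B1 :: B1 is "UNIV" .

lift_definition less_eq_B1 :: "B1 \<Rightarrow> B1 \<Rightarrow> bool" is "\<lambda>A B. A - B \<in> Fin"
  by (rule Diff_in_ideal_cong[OF set_ideal_Fin])

definition less_B1 :: "B1 \<Rightarrow> B1 \<Rightarrow> bool" where
  "less_B1 x y \<longleftrightarrow> x \<le> y \<and> \<not> y \<le> x"

instance
proof
  fix x y z :: B1
  note [simp] = eq_mod_def Fin_def
  show "x < y \<longleftrightarrow> x \<le> y \<and> \<not> y \<le> x" by (rule less_B1_def)
  show "x \<le> x" by transfer simp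
  show "x \<le> y \<Longrightarrow> y \<le> z \<Longrightarrow> x \<le> z"
    by transfer (rule Diff_in_ideal_trans[OF set_ideal_Fin])
  show "x \<le> y \<Longrightarrow> y \<le> x \<Longrightarrow> x = y"
    by transfer (rule Diff_in_ideal_antisym[OF set_ideal_Fin])
  show "inf x y \<le> x" "inf x y \<le> y" "x \<le> sup x y" "y \<le> sup x y"
    by (transfer; simp add: Diff_eq Int_ac)+
  show "x \<le> y \<Longrightarrow> x \<le> z \<Longrightarrow> x \<le> inf y z"
    by transfer (simp add: Diff_Int)
  show "y \<le> x \<Longrightarrow> z \<le> x \<Longrightarrow> sup y z \<le> x"
    by transfer (simp add: Un_Diff)
  show "bot \<le> x" "x \<le> top" by (transfer; simp)+
  show "sup x (inf y z) = inf (sup x y) (sup x z)" by transfer (simp add: Un_Int_distrib)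
  show "inf x (- x) = bot" "sup x (- x) = top" by (transfer; simp)+
  show "x - y = inf x (- y)" by transfer (simp add: Diff_eq)
qed

end


section \<open>The algebra of sets of binary words modulo sets without infinite antichains\<close>

datatype letter = l | r

hide_const (open) l r

type_synonym word_tree = "letter list"

definition no_inf_antichain :: "word_tree set set" where
  "no_inf_antichain = {B. \<not> (\<exists>A\<subseteq>B. infinite A \<and> pairwise (\<parallel>) A)}"

lemma set_ideal_no_inf_antichain: "set_ideal no_inf_antichain"
  unfolding set_ideal_def
proof (intro conjI ballI allI impI)
  show "{} \<in> no_inf_antichain"
    by (auto simp: no_inf_antichain_def)
next
  fix A B assume "A \<in> no_inf_antichain" "B \<subseteq> A"
  then show "B \<in> no_inf_antichain"
    unfolding no_inf_antichain_def mem_Collect_eq using subset_trans by metis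
next
  fix A B assume AB: "A \<in> no_inf_antichain" "B \<in> no_inf_antichain"
  show "A \<union> B \<in> no_inf_antichain"
    unfolding no_inf_antichain_def
  proof (rule CollectI, rule notI)
    assume "\<exists>C\<subseteq>A \<union> B. infinite C \<and> pairwise (\<parallel>) C"
    then obtain C where C: "C \<subseteq> A \<union> B" "infinite C" "pairwise (\<parallel>) C" by blast
    have "C = (C \<inter> A) \<union> (C \<inter> B)" using C(1) by blast
    then have "infinite (C \<inter> A) \<or> infinite (C \<inter> B)"
      using C(2) by (metis finite_UnI)
    moreover have "pairwise (\<parallel>) (C \<inter> A)" "pairwise (\<parallel>) (C \<inter> B)"
      by (rule pairwise_subset[OF C(3) Int_lower1])+
    ultimately show False
      using AB Int_lower2[of C A] Int_lower2[of C B] unfolding no_inf_antichain_def by blast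
  qed
qed

quotient_type B2 = "word_tree set" / "eq_mod no_inf_antichain"
  by (rule equivp_eq_mod[OF set_ideal_no_inf_antichain])

instantiation B2 :: boolean_algebra
begin

lift_definition inf_B2 :: "B2 \<Rightarrow> B2 \<Rightarrow> B2" is "(\<inter>)"
  by (rule eq_mod_Int[OF set_ideal_no_inf_antichain])

lift_definition sup_B2 :: "B2 \<Rightarrow> B2 \<Rightarrow> B2" is "(\<union>)"
  by (rule eq_mod_Un[OF set_ideal_no_inf_antichain])

lift_definition uminus_B2 :: "B2 \<Rightarrow> B2" is "\<lambda>A. - A"
  by (rule eq_mod_Compl)

lift_definition minus_B2 :: "B2 \<Rightarrow> B2 \<Rightarrow> B2" is "\<lambda>A B. A - B"
  by (rule eq_mod_Diff[OF set_ideal_no_inf_antichain])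

lift_definition bot_B2 :: B2 is "{}" .

lift_definition top_B2 :: B2 is "UNIV" .

lift_definition less_eq_B2 :: "B2 \<Rightarrow> B2 \<Rightarrow> bool" is "\<lambda>A B. A - B \<in> no_inf_antichain"
  by (rule Diff_in_ideal_cong[OF set_ideal_no_inf_antichain])

definition less_B2 :: "B2 \<Rightarrow> B2 \<Rightarrow> bool" where
  "less_B2 x y \<longleftrightarrow> x \<le> y \<and> \<not> y \<le> x"

instance
proof
  fix x y z :: B2
  have [simp]: "{} \<in> no_inf_antichain"
    using set_ideal_no_inf_antichain by (simp add: set_ideal_def)
  note [simp] = eq_mod_def
  show "x < y \<longleftrightarrow> x \<le> y \<and> \<not> y \<le> x" by (rule less_B2_def)
  show "x \<le> x" by transfer simp
  show "x \<le> y \<Longrightarrow> y \<le> z \<Longrightarrow> x \<le> z"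
    by transfer (rule Diff_in_ideal_trans[OF set_ideal_no_inf_antichain])
  show "x \<le> y \<Longrightarrow> y \<le> x \<Longrightarrow> x = y"
    by transfer (rule Diff_in_ideal_antisym[OF set_ideal_no_inf_antichain])
  show "inf x y \<le> x" "inf x y \<le> y" "x \<le> sup x y" "y \<le> sup x y"
    by (transfer; simp add: Diff_eq Int_ac)+
  show "x \<le> y \<Longrightarrow> x \<le> z \<Longrightarrow> x \<le> inf y z"
    by transfer (simp add: Diff_Int set_ideal_Un[OF set_ideal_no_inf_antichain])
  show "y \<le> x \<Longrightarrow> z \<le> x \<Longrightarrow> sup y z \<le> x"
    by transfer (simp add: Un_Diff set_ideal_Un[OF set_ideal_no_inf_antichain])
  show "bot \<le> x" "x \<le> top" by (transfer; simp)+
  show "sup x (inf y z) = inf (sup x y) (sup x z)" by transfer (simp add: Un_Int_distrib)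
  show "inf x (- x) = bot" "sup x (- x) = top" by (transfer; simp)+
  show "x - y = inf x (- y)" by transfer (simp add: Diff_eq)
qed

end


section \<open>Isomorphism of boolean algebras\<close>

definition boolean_algebra_iso :: "('a::boolean_algebra \<Rightarrow> 'b::boolean_algebra) \<Rightarrow> bool" where
  "boolean_algebra_iso f \<longleftrightarrow>
     bij f \<and>
     (\<forall>x y. f (inf x y) = inf (f x) (f y)) \<and>
     (\<forall>x y. f (sup x y) = sup (f x) (f y)) \<and>
     (\<forall>x. f (- x) = - f x) \<and>
     f bot = bot \<and> f top = top"


section \<open>The set-theoretic hypotheses\<close>

text \<open>\<open>2\<^sup>\<aleph>\<^sup>0 = \<aleph>\<^sub>1\<close>, where \<^const>\<open>natLeq\<close> is the cardinal \<open>\<aleph>\<^sub>0\<close>.\<close>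

definition CH :: bool where
  "CH \<longleftrightarrow> (card_of (UNIV :: nat set set), cardSuc natLeq) \<in> ordIso"

text \<open>
  Todorcevic's Open Coloring Axiom: if \<open>M\<close> is a separable metric space and the set \<open>[M]\<^sup>2\<close> of
  two-element subsets of \<open>M\<close> is partitioned into \<open>K\<^sub>0\<close> and \<open>K\<^sub>1\<close> with \<open>K\<^sub>0\<close> open, then either
  \<open>M\<close> has an uncountable subset \<open>Y\<close> with \<open>[Y]\<^sup>2 \<subseteq> K\<^sub>0\<close>, or \<open>M\<close> is a countable union of sets \<open>X\<^sub>n\<close>
  with \<open>[X\<^sub>n]\<^sup>2 \<subseteq> K\<^sub>1\<close>. Openness of \<open>K\<^sub>0\<close> means that the corresponding symmetric set of ordered
  pairs is open in \<open>M \<times> M\<close>.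

  The points are taken to be real numbers, but the metric \<open>d\<close> is arbitrary and unrelated to the
  usual distance. This is no restriction: a separable metric space has at most continuum many
  points, hence is isometric to one whose underlying set is a set of reals.
\<close>

definition OCA :: bool where
  "OCA \<longleftrightarrow>
     (\<forall>(M :: real set) d K\<^sub>0 K\<^sub>1.
        Metric_space M d \<and> separable_space (Metric_space.mtopology M d) \<and>
        K\<^sub>0 \<union> K\<^sub>1 = nsets M 2 \<and> K\<^sub>0 \<inter> K\<^sub>1 = {} \<and>
        openin (prod_topology (Metric_space.mtopology M d) (Metric_space.mtopology M d))
          {(x, y). {x, y} \<in> K\<^sub>0}
        \<longrightarrow>
        (\<exists>Y\<subseteq>M. uncountable Y \<and> nsets Y 2 \<subseteq> K\<^sub>0) \<or>
        (\<exists>X :: nat \<Rightarrow> real set. M = (\<Union>n. X n) \<and> (\<forall>n. nsets (X n) 2 \<subseteq> K\<^sub>1)))"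

end

theory Submission
  imports Defs
begin

text \<open>
  Under CH both algebras have at most \<open>\<aleph>\<^sub>1\<close> elements, and both are countably saturated because
  both ideals are \<open>F\<^sub>\<sigma>\<close>: a set is positive as soon as it contains finite sets that are large
  without bound (for the tree, because unbounded finite antichains yield an infinite one). A
  back-and-forth construction of length \<open>\<omega>\<^sub>1\<close> then gives an isomorphism.

  For the second part, the words \<open>l\<^sup>n r\<^sup>v\<^sup>+\<^sup>1\<close> embed \<open>\<nat> \<times> \<nat>\<close>, modulo the sets meeting only finitely
  many columns, into the second algebra; so an isomorphism lifts to a map \<open>G\<close> from subsets of
  \<open>\<nat> \<times> \<nat>\<close> to subsets of \<open>\<nat>\<close>. OCA is applied to functions \<open>f\<close> on the branches \<open>x\<close> of a binary tree
  of columns: the colouring makes a homogeneous set force \<open>G (f)\<close> to depend continuously on \<open>f\<close>, so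
  for one fixed branch, \<open>\<omega>\<^sup>\<omega>\<close> is a countable union of pieces on each of which \<open>G\<close> is uniformly
  continuous. On a nonmeager piece \<open>G\<close> extends to a uniformly continuous map \<open>U\<close> into Cantor space,
  and a Kuratowski--Ulam argument shows that on a smaller open set \<open>U\<close> respects supports up to a
  finite error that is uniform in \<open>f\<close>. Since each column is infinite while \<open>U\<close> only has finitely
  many values on a finite segment, \<open>U\<close> cannot distinguish two values \<open>v n \<noteq> w n\<close> at infinitely many
  columns \<open>j n\<close>; two functions in the nonmeager piece taking these values infinitely often together
  contradict the injectivity of the embedding.
\<close>

section \<open>Back-and-forth for saturated Boolean algebras\<close>

text \<open>
  A subalgebra of the product meeting both axes trivially is the graph of an isomorphism between
  subalgebras; this form is symmetric and closed under unions of chains.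
\<close>

definition partial_iso :: "('a::boolean_algebra \<times> 'b::boolean_algebra) set \<Rightarrow> bool" where
  "partial_iso R \<longleftrightarrow> (bot, bot) \<in> R \<and> (\<forall>(a, b)\<in>R. (- a, - b) \<in> R) \<and>
     (\<forall>(a, b)\<in>R. \<forall>(c, d)\<in>R. (inf a c, inf b d) \<in> R) \<and> (\<forall>(a, b)\<in>R. a = bot \<longleftrightarrow> b = bot)"

text \<open>The one-element form of countable saturation: the type of \<open>b\<close> asks that
  \<open>b\<close> lie above all \<open>x n\<close>, miss all \<open>y n\<close>, meet every member
  of \<open>C\<close> and have a complement meeting every member of \<open>D\<close>. The hypotheses
  say that each single demand is consistent with the order constraints.\<close>

definition saturated :: "'b::boolean_algebra itself \<Rightarrow> bool" where
  "saturated _ \<longleftrightarrow> (\<forall>(x :: nat \<Rightarrow> 'b) y C D.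
     mono x \<and> mono y \<and> (\<forall>n. inf (x n) (y n) = bot) \<and>
     countable C \<and> countable D \<and> C \<noteq> {} \<and> D \<noteq> {} \<and>
     (\<forall>c\<in>C. \<forall>n. inf c (- y n) \<noteq> bot) \<and> (\<forall>c\<in>D. \<forall>n. inf c (- x n) \<noteq> bot) \<longrightarrow>
     (\<exists>b. (\<forall>n. x n \<le> b \<and> inf b (y n) = bot) \<and> (\<forall>c\<in>C. inf c b \<noteq> bot) \<and> (\<forall>c\<in>D. inf c (- b) \<noteq> bot)))"

text \<open>Greedy choice: \<open>p n\<close> is the finite union of the sets chosen before stage
  \<open>n\<close>, and the next set is taken outside it. \<open>L n F\<close> reads
  "\<open>F\<close> is large of order \<open>n\<close>".\<close>

lemma disjoint_finite_selection:
  assumes "\<And>n P. finite P \<Longrightarrow> \<exists>F. F \<subseteq> A n - P \<and> finite F \<and> L n F"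
  obtains F :: "nat \<Rightarrow> 'a set" where "\<And>n. F n \<subseteq> A n" "\<And>n. finite (F n)" "\<And>n. L n (F n)"
    "\<And>m n. m \<noteq> n \<Longrightarrow> F m \<inter> F n = {}"
proof -
  define sel where "sel n P = (SOME F. F \<subseteq> A n - P \<and> finite F \<and> L n F)" for n P
  define p where "p = rec_nat {} (\<lambda>n P. P \<union> sel n P)"
  have sel: "sel n P \<subseteq> A n - P \<and> finite (sel n P) \<and> L n (sel n P)" if "finite P" for n P
    unfolding sel_def by (rule someI_ex[OF assms[OF that]])
  have p: "p (Suc n) = p n \<union> sel n (p n)" "p 0 = {}" for n by (simp_all add: p_def)
  have fin: "finite (p n)" for n by (induction n) (use sel p in auto)
  define F where "F n = sel n (p n)" for n
  have p_mono: "p m \<subseteq> p n" if "m \<le> n" for m n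
    using that by (induction n rule: dec_induct) (auto simp: p)
  have F_sub: "F m \<subseteq> p n" if "m < n" for m n
    using p_mono[of "Suc m" n] that unfolding F_def p(1) by simp
  have "F m \<inter> p m = {}" for m using sel[OF fin[of m], of m] unfolding F_def by blast
  then have "F m \<inter> F n = {}" if "m < n" for m n using F_sub[OF that] by blast
  then have "F m \<inter> F n = {}" if "m \<noteq> n" for m n
    using that by (cases m n rule: linorder_cases) (auto simp: Int_commute)
  then show ?thesis using that[of F] sel[OF fin] unfolding F_def by blast
qed

text \<open>The largeness \<open>L\<close> expresses that \<open>J\<close> is an F_sigma ideal.
  Disjoint finite large pieces of the sets \<open>c n - Y n\<close> are added to a separator of the
  \<open>X n\<close> from the \<open>Y n\<close>, and pieces of the \<open>d n - X n\<close> are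
  removed. Only the first \<open>m\<close> pieces can disturb \<open>X m\<close> or
  \<open>Y m\<close>, so the error is finite, while every member of \<open>C\<close> and
  \<open>D\<close> receives pieces of unbounded order.\<close>

lemma saturated_quotient:
  fixes q :: "'a set \<Rightarrow> 'b::boolean_algebra"
  assumes J: "set_ideal J" and surj: "\<And>b. \<exists>A. q A = b"
    and q_Int: "\<And>A B. q (A \<inter> B) = inf (q A) (q B)" and q_Compl: "\<And>A. q (- A) = - q A"
    and q_bot: "\<And>A. q A = bot \<longleftrightarrow> A \<in> J"
    and fin: "\<And>F. finite F \<Longrightarrow> F \<in> J"
    and large: "\<And>A n. A \<notin> J \<Longrightarrow> \<exists>F\<subseteq>A. finite F \<and> L (n::nat) F"
    and positive: "\<And>A. (\<And>n. \<exists>k\<ge>n. \<exists>F\<subseteq>A. L k F) \<Longrightarrow> A \<notin> J"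
  shows "saturated TYPE('b)"
  unfolding saturated_def
proof (intro allI impI, elim conjE)
  fix x y :: "nat \<Rightarrow> 'b" and C D
  assume x: "mono x" and y: "mono y" and xy: "\<forall>n. inf (x n) (y n) = bot"
    and C: "countable C" "C \<noteq> {}" "\<forall>c\<in>C. \<forall>n. inf c (- y n) \<noteq> bot"
    and D: "countable D" "D \<noteq> {}" "\<forall>c\<in>D. \<forall>n. inf c (- x n) \<noteq> bot"
  have q_Un: "q (A \<union> B) = sup (q A) (q B)" for A B
    using q_Compl[of "- A \<inter> - B"] q_Int[of "- A" "- B"] q_Compl[of A] q_Compl[of B] by simp
  have rep: "\<exists>X. (\<forall>n. q (X n) = x n) \<and> mono X" if x: "mono x" for x :: "nat \<Rightarrow> 'b"
  proof -
    define X where "X n = (SOME A. q A = x n)" for n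
    have X: "q (X n) = x n" for n unfolding X_def by (rule someI_ex[OF surj])
    \<comment> \<open>Finite unions make the representatives increasing as sets, not only modulo
      \<open>J\<close>; monotonicity of \<open>x\<close> keeps their classes.\<close>
    have "q (\<Union>m\<le>n. X m) = x n" for n
    proof (induction n)
      case (Suc n)
      have "(\<Union>m\<le>Suc n. X m) = (\<Union>m\<le>n. X m) \<union> X (Suc n)" by (auto simp: atMost_Suc)
      then show ?case using Suc q_Un X x by (simp add: sup_absorb2 monoD)
    qed (simp add: X)
    moreover have "mono (\<lambda>n. \<Union>m\<le>n. X m)" by (rule monoI) force
    ultimately show ?thesis by (intro exI[of _ "\<lambda>n. \<Union>m\<le>n. X m"]) simp
  qed
  obtain X where X: "\<And>n. q (X n) = x n" "mono X" using rep[OF x] by blast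
  obtain Y where Y: "\<And>n. q (Y n) = y n" "mono Y" using rep[OF y] by blast
  have XY: "X n \<inter> Y n \<in> J" for n using xy X Y q_Int q_bot by metis
  obtain r where r: "\<And>b. q (r b) = b" using surj by metis
  \<comment> \<open>Decoding \<open>n\<close> as a pair lists each element of \<open>C\<close>
    infinitely often, at arbitrarily late stages. Below, even stages serve \<open>C\<close> and odd
    stages serve \<open>D\<close>.\<close>
  define c where "c n = r (from_nat_into C (fst (prod_decode n)))" for n
  define d where "d n = r (from_nat_into D (fst (prod_decode n)))" for n
  define A where "A n = (if even n then c (n div 2) - Y (n div 2) else d (n div 2) - X (n div 2))" for n
  have "c n - Y n \<notin> J" for n
    using C(3) from_nat_into[OF C(2)] q_Int[of "c n" "- Y n"] q_bot q_Compl Y r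
    unfolding c_def Diff_eq by metis
  moreover have "d n - X n \<notin> J" for n
    using D(3) from_nat_into[OF D(2)] q_Int[of "d n" "- X n"] q_bot q_Compl X r
    unfolding d_def Diff_eq by metis
  ultimately have AJ: "A n \<notin> J" for n by (simp add: A_def)
  have sel: "\<exists>F. F \<subseteq> A n - P \<and> finite F \<and> L n F" if "finite P" for n P
  proof -
    have "A n - P \<notin> J"
    proof
      assume "A n - P \<in> J"
      then have "(A n - P) \<union> P \<in> J" using fin[OF that] by (rule set_ideal_Un[OF J])
      then have "A n \<in> J" by (rule set_ideal_subset[OF J]) auto
      then show False using AJ by simp
    qed
    then show ?thesis using large by blast
  qed
  obtain F where F: "\<And>n. F n \<subseteq> A n" "\<And>n. finite (F n)" "\<And>n. L n (F n)"
    "\<And>m n. m \<noteq> n \<Longrightarrow> F m \<inter> F n = {}"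
    by (rule disjoint_finite_selection[of A L, OF sel]) blast+
  define F1 where "F1 = (\<Union>n. F (2 * n))"
  define F2 where "F2 = (\<Union>n. F (2 * n + 1))"
  have F1: "F (2 * n) \<subseteq> c n - Y n" and F2: "F (2 * n + 1) \<subseteq> d n - X n" for n
    using F(1)[of "2 * n"] F(1)[of "2 * n + 1"] by (simp_all add: A_def)
  have disj: "F1 \<inter> F2 = {}"
  proof -
    have "F (2 * m) \<inter> F (2 * n + 1) = {}" for m n by (intro F(4)) presburger
    then show ?thesis unfolding F1_def F2_def by blast
  qed
  \<comment> \<open>The separator before correction: both \<open>X m - \<beta>\<close> and
    \<open>\<beta> \<inter> Y m\<close> are contained in \<open>X m \<inter> Y m\<close>, the latter
    because both sequences increase.\<close>
  define \<beta> where "\<beta> = (\<Union>n. X n - Y n)"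
  define b where "b = (\<beta> \<union> F1) - F2"
  have le: "q S \<le> q T \<longleftrightarrow> S - T \<in> J" for S T
    using q_Int[of S "- T"] q_Compl[of T] q_bot[of "S \<inter> - T"] by (simp add: Diff_eq inf_shunt)
  have "x m \<le> q b" for m
  proof -
    have "X m \<inter> F2 \<subseteq> (\<Union>n<m. F (2 * n + 1))"
    proof
      fix s assume "s \<in> X m \<inter> F2"
      then obtain n where n: "s \<in> F (2 * n + 1)" "s \<in> X m" by (auto simp: F2_def)
      then have "\<not> m \<le> n" using F2[of n] monoD[OF X(2), of m n] by blast
      then show "s \<in> (\<Union>n<m. F (2 * n + 1))" using n by auto
    qed
    then have "X m \<inter> F2 \<in> J" using F(2) by (intro fin) (auto elim: finite_subset)
    then have "X m \<inter> Y m \<union> X m \<inter> F2 \<in> J" by (rule set_ideal_Un[OF J XY])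
    then have "X m - b \<in> J" by (rule set_ideal_subset[OF J]) (auto simp: b_def \<beta>_def)
    then show ?thesis using le X(1) by metis
  qed
  moreover have "inf (q b) (y m) = bot" for m
  proof -
    have "Y m \<inter> F1 \<subseteq> (\<Union>n<m. F (2 * n))"
    proof
      fix s assume "s \<in> Y m \<inter> F1"
      then obtain n where n: "s \<in> F (2 * n)" "s \<in> Y m" by (auto simp: F1_def)
      then have "\<not> m \<le> n" using F1[of n] monoD[OF Y(2), of m n] by blast
      then show "s \<in> (\<Union>n<m. F (2 * n))" using n by auto
    qed
    then have "Y m \<inter> F1 \<in> J" using F(2) by (intro fin) (auto elim: finite_subset)
    then have *: "X m \<inter> Y m \<union> Y m \<inter> F1 \<in> J" by (rule set_ideal_Un[OF J XY])
    have "\<beta> \<inter> Y m \<subseteq> X m \<inter> Y m"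
    proof
      fix s assume "s \<in> \<beta> \<inter> Y m"
      then obtain n where n: "s \<in> X n" "s \<notin> Y n" "s \<in> Y m" by (auto simp: \<beta>_def)
      then have "\<not> m \<le> n" using monoD[OF Y(2), of m n] by blast
      then show "s \<in> X m \<inter> Y m" using n monoD[OF X(2), of n m] by auto
    qed
    then have "b \<inter> Y m \<in> J" by (intro set_ideal_subset[OF J *]) (auto simp: b_def)
    then show ?thesis using q_bot q_Int Y(1) by metis
  qed
  moreover have "inf a (q b) \<noteq> bot" if a: "a \<in> C" for a
  proof -
    obtain i where i: "from_nat_into C i = a" using from_nat_into_surj[OF C(1) a] by blast
    have "r a \<inter> b \<notin> J"
    proof (rule positive)
      fix n
      define k where "k = prod_encode (i, n)"
      have "n \<le> k" unfolding k_def by (rule le_prod_encode_2)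
      moreover have "F (2 * k) \<subseteq> r a \<inter> b"
        using F1[of k] disj i unfolding b_def F1_def by (auto simp: c_def k_def)
      ultimately show "\<exists>k\<ge>n. \<exists>F\<subseteq>r a \<inter> b. L k F" using F(3)[of "2 * k"] by (intro exI[of _ "2 * k"]) auto
    qed
    then show ?thesis using q_bot q_Int r by metis
  qed
  moreover have "inf a (- q b) \<noteq> bot" if a: "a \<in> D" for a
  proof -
    obtain i where i: "from_nat_into D i = a" using from_nat_into_surj[OF D(1) a] by blast
    have "r a \<inter> - b \<notin> J"
    proof (rule positive)
      fix n
      define k where "k = prod_encode (i, n)"
      have "n \<le> k" unfolding k_def by (rule le_prod_encode_2)
      moreover have "F (2 * k + 1) \<subseteq> r a \<inter> - b"
        using F2[of k] i unfolding b_def F2_def by (auto simp: d_def k_def)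
      ultimately show "\<exists>k\<ge>n. \<exists>F\<subseteq>r a \<inter> - b. L k F"
        using F(3)[of "2 * k + 1"] by (intro exI[of _ "2 * k + 1"]) auto
    qed
    then show ?thesis using q_bot q_Int q_Compl r by metis
  qed
  ultimately show "\<exists>b. (\<forall>n. x n \<le> b \<and> inf b (y n) = bot) \<and> (\<forall>c\<in>C. inf c b \<noteq> bot) \<and>
      (\<forall>c\<in>D. inf c (- b) \<noteq> bot)"
    by (intro exI[of _ "q b"]) blast
qed

lemma partial_isoI:
  assumes "(bot, bot) \<in> R" "\<And>a b. (a, b) \<in> R \<Longrightarrow> (- a, - b) \<in> R"
    "\<And>a b c d. (a, b) \<in> R \<Longrightarrow> (c, d) \<in> R \<Longrightarrow> (inf a c, inf b d) \<in> R"
    "\<And>a b. (a, b) \<in> R \<Longrightarrow> a = bot \<longleftrightarrow> b = bot"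
  shows "partial_iso R"
  unfolding partial_iso_def
proof (intro conjI)
  show "\<forall>(a, b)\<in>R. \<forall>(c, d)\<in>R. (inf a c, inf b d) \<in> R" using assms(3) by blast
  show "\<forall>(a, b)\<in>R. (- a, - b) \<in> R" using assms(2) by blast
  show "\<forall>(a, b)\<in>R. a = bot \<longleftrightarrow> b = bot" using assms(4) by blast
qed (fact assms(1))

lemma partial_isoD:
  assumes "partial_iso R"
  shows "(bot, bot) \<in> R" "(a, b) \<in> R \<Longrightarrow> (- a, - b) \<in> R"
    "(a, b) \<in> R \<Longrightarrow> (c, d) \<in> R \<Longrightarrow> (inf a c, inf b d) \<in> R"
    "(a, b) \<in> R \<Longrightarrow> (c, d) \<in> R \<Longrightarrow> (sup a c, sup b d) \<in> R"
    "(a, b) \<in> R \<Longrightarrow> a = bot \<longleftrightarrow> b = bot"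
    "(top, top) \<in> R"
    "(a, b) \<in> R \<Longrightarrow> (c, d) \<in> R \<Longrightarrow> a \<le> c \<longleftrightarrow> b \<le> d"
proof -
  have bot: "(bot, bot) \<in> R" and Compl: "\<And>a b. (a, b) \<in> R \<Longrightarrow> (- a, - b) \<in> R"
    and Inf: "\<And>a b c d. (a, b) \<in> R \<Longrightarrow> (c, d) \<in> R \<Longrightarrow> (inf a c, inf b d) \<in> R"
    and Bot: "\<And>a b. (a, b) \<in> R \<Longrightarrow> a = bot \<longleftrightarrow> b = bot"
    using assms unfolding partial_iso_def by fast+
  show "(bot, bot) \<in> R" "(a, b) \<in> R \<Longrightarrow> (- a, - b) \<in> R"
    "(a, b) \<in> R \<Longrightarrow> (c, d) \<in> R \<Longrightarrow> (inf a c, inf b d) \<in> R"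
    "(a, b) \<in> R \<Longrightarrow> a = bot \<longleftrightarrow> b = bot"
    by (fact bot Compl Inf Bot)+
  show "(sup a c, sup b d) \<in> R" if "(a, b) \<in> R" "(c, d) \<in> R"
    using Compl[OF Inf[OF Compl[OF that(1)] Compl[OF that(2)]]] by simp
  show "(top, top) \<in> R" using Compl[OF bot] by simp
  show "a \<le> c \<longleftrightarrow> b \<le> d" if "(a, b) \<in> R" "(c, d) \<in> R"
    using Bot[OF Inf[OF that(1) Compl[OF that(2)]]] by (simp add: inf_shunt)
qed

lemma partial_iso_converse: "partial_iso R \<Longrightarrow> partial_iso (R\<inverse>)"
  unfolding partial_iso_def by fast

lemma partial_iso_Union:
  assumes "\<F> \<noteq> {}" "\<And>R. R \<in> \<F> \<Longrightarrow> partial_iso R"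
    "\<And>R S. R \<in> \<F> \<Longrightarrow> S \<in> \<F> \<Longrightarrow> R \<subseteq> S \<or> S \<subseteq> R"
  shows "partial_iso (\<Union>\<F>)"
proof -
  have "(inf a c, inf b d) \<in> \<Union>\<F>" if ab: "(a, b) \<in> \<Union>\<F>" and cd: "(c, d) \<in> \<Union>\<F>" for a b c d
  proof -
    obtain R S where "R \<in> \<F>" "(a, b) \<in> R" "S \<in> \<F>" "(c, d) \<in> S" using ab cd by blast
    then obtain T where "T \<in> \<F>" "(a, b) \<in> T" "(c, d) \<in> T" using assms(3) by blast
    then show ?thesis using partial_isoD(3)[OF assms(2)] by blast
  qed
  moreover have "(bot, bot) \<in> \<Union>\<F>" using assms(1) partial_isoD(1)[OF assms(2)] by blast
  moreover have "(- a, - b) \<in> \<Union>\<F>" if "(a, b) \<in> \<Union>\<F>" for a b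
    using that partial_isoD(2)[OF assms(2)] by blast
  moreover have "a = bot \<longleftrightarrow> b = bot" if "(a, b) \<in> \<Union>\<F>" for a b
    using that partial_isoD(5)[OF assms(2)] by blast
  ultimately show ?thesis by (intro partial_isoI)
qed

lemma increasing_cofinal_sequence:
  fixes A :: "'a::boolean_algebra set"
  assumes "countable A" "A \<noteq> {}" "\<And>a b. a \<in> A \<Longrightarrow> b \<in> A \<Longrightarrow> sup a b \<in> A"
  obtains x :: "nat \<Rightarrow> 'a" where "mono x" "\<And>n. x n \<in> A" "\<And>a. a \<in> A \<Longrightarrow> \<exists>n. a \<le> x n"
proof
  define x where "x = rec_nat (from_nat_into A 0) (\<lambda>n y. sup y (from_nat_into A (Suc n)))"
  have x: "x 0 = from_nat_into A 0" "x (Suc n) = sup (x n) (from_nat_into A (Suc n))" for n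
    by (simp_all add: x_def)
  show "mono x" by (simp add: mono_iff_le_Suc x)
  show "x n \<in> A" for n by (induction n) (simp_all add: x assms from_nat_into)
  fix a assume "a \<in> A"
  then obtain n where "a = from_nat_into A n" using from_nat_into_surj[OF assms(1)] by metis
  then show "\<exists>n. a \<le> x n" by (intro exI[of _ n]) (cases n; simp add: x)
qed

text \<open>The element equal to \<open>a\<close> on \<open>b\<close> and to \<open>c\<close> on the
  complement of \<open>b\<close>. With \<open>a\<close> and \<open>c\<close> in a subalgebra, these
  elements form the subalgebra generated by it and \<open>b\<close>.\<close>

definition comb :: "'a::boolean_algebra \<Rightarrow> 'a \<Rightarrow> 'a \<Rightarrow> 'a" where
  "comb b a c = sup (inf a b) (inf c (- b))"

lemma image_swap_eq_converse: "prod.swap ` R = R\<inverse>"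
  by force

lemma comb_inf: "inf (comb b a c) (comb b a' c') = comb b (inf a a') (inf c c')"
proof -
  have "inf (inf a b) (inf c' (- b)) = bot" "inf (inf c (- b)) (inf a' b) = bot"
    by (simp_all add: inf_aci)
  then show ?thesis
    by (simp add: comb_def inf_sup_distrib1 inf_sup_distrib2 inf_aci)
qed

lemma comb_same: "comb b a a = a"
  by (simp add: comb_def flip: inf_sup_distrib1)

lemma comb_compl: "- comb b a c = comb b (- a) (- c)"
proof (rule compl_unique)
  show "inf (comb b a c) (comb b (- a) (- c)) = bot" by (simp add: comb_inf) (simp add: comb_def)
  have "sup (comb b a c) (comb b (- a) (- c)) =
      sup (inf (sup a (- a)) b) (inf (sup c (- c)) (- b))"
    unfolding comb_def inf_sup_distrib2 by (simp only: sup_aci)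
  then show "sup (comb b a c) (comb b (- a) (- c)) = top" by simp
qed

text \<open>Saturation realizes the image under \<open>R\<close> of the type of \<open>b\<close>
  over the countable domain. The pairs of piecewise elements built from \<open>b\<close> and its
  partner \<open>b'\<close> then form the extension; preservation of \<open>bot\<close> in both
  directions encodes that it is well defined and injective.\<close>

lemma partial_iso_extend:
  fixes R :: "('a::boolean_algebra \<times> 'b::boolean_algebra) set"
  assumes sat: "saturated TYPE('b)" and R: "partial_iso R" "countable R"
  obtains R' where "partial_iso R'" "countable R'" "R \<subseteq> R'" "b \<in> Domain R'"
proof (cases "b \<in> Domain R")
  case False
  note D = partial_isoD[OF R(1)]
  \<comment> \<open>\<open>X\<close> and \<open>Y\<close> hold the partners of elements below
    \<open>b\<close> and disjoint from \<open>b\<close>; \<open>P\<close> and \<open>N\<close> hold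
    the partners of elements meeting \<open>b\<close> and meeting \<open>- b\<close>.\<close>
  define X where "X = {a' |a a'. (a, a') \<in> R \<and> a \<le> b}"
  define Y where "Y = {a' |a a'. (a, a') \<in> R \<and> inf a b = bot}"
  define P where "P = {a' |a a'. (a, a') \<in> R \<and> inf a b \<noteq> bot}"
  define N where "N = {a' |a a'. (a, a') \<in> R \<and> inf a (- b) \<noteq> bot}"
  have sub: "X \<subseteq> snd ` R" "Y \<subseteq> snd ` R" "P \<subseteq> snd ` R" "N \<subseteq> snd ` R"
    by (force simp: X_def Y_def P_def N_def)+
  have cnt: "countable X" "countable Y" "countable P" "countable N"
    by (rule countable_subset[OF sub(1)] countable_subset[OF sub(2)] countable_subset[OF sub(3)]
        countable_subset[OF sub(4)]; use R(2) in simp)+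
  have bX: "bot \<in> X" "bot \<in> Y" using D(1) by (auto simp: X_def Y_def)
  have "b \<noteq> bot" "b \<noteq> top" using False D(1,6) by auto
  then have "inf top b \<noteq> bot" "inf top (- b) \<noteq> bot"
    by (simp, metis inf_top_left compl_bot_eq double_compl)
  then have tP: "top \<in> P" "top \<in> N" using D(6) unfolding P_def N_def by blast+
  have supX: "sup a c \<in> X" if "a \<in> X" "c \<in> X" for a c
    using that D(4) unfolding X_def by clarsimp (metis le_supI)
  have supY: "sup a c \<in> Y" if "a \<in> Y" "c \<in> Y" for a c
    using that D(4) unfolding Y_def by clarsimp (metis inf_sup_distrib2 sup_bot.right_neutral)
  obtain x :: "nat \<Rightarrow> 'b" where x: "mono x" "\<And>n. x n \<in> X" "\<And>a. a \<in> X \<Longrightarrow> \<exists>n. a \<le> x n"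
    using increasing_cofinal_sequence[OF cnt(1) _ supX] bX by blast
  obtain y :: "nat \<Rightarrow> 'b" where y: "mono y" "\<And>n. y n \<in> Y" "\<And>a. a \<in> Y \<Longrightarrow> \<exists>n. a \<le> y n"
    using increasing_cofinal_sequence[OF cnt(2) _ supY] bX by blast
  have xy: "inf (x n) (y n) = bot" for n
  proof -
    obtain a c where a: "(a, x n) \<in> R" "a \<le> b" and c: "(c, y n) \<in> R" "inf c b = bot"
      using x(2)[of n] y(2)[of n] by (auto simp: X_def Y_def)
    have "inf a c \<le> inf c b" using a(2) by (simp add: le_infI1)
    then have "inf a c = bot" using c(2) by (simp add: bot_unique)
    then show ?thesis using D(5)[OF D(3)[OF a(1) c(1)]] by simp
  qed
  have Py: "inf p (- y n) \<noteq> bot" if p: "p \<in> P" for p n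
  proof
    assume "inf p (- y n) = bot"
    moreover obtain a c where a: "(a, p) \<in> R" "inf a b \<noteq> bot" and c: "(c, y n) \<in> R" "inf c b = bot"
      using p y(2)[of n] by (auto simp: P_def Y_def)
    ultimately have "a \<le> c" using D(7)[OF a(1) c(1)] by (simp add: inf_shunt)
    then have "inf a b \<le> inf c b" by (rule inf_mono) simp
    then show False using a(2) c(2) by (simp add: bot_unique)
  qed
  have Nx: "inf p (- x n) \<noteq> bot" if p: "p \<in> N" for p n
  proof
    assume "inf p (- x n) = bot"
    moreover obtain a c where a: "(a, p) \<in> R" "inf a (- b) \<noteq> bot" and c: "(c, x n) \<in> R" "c \<le> b"
      using p x(2)[of n] by (auto simp: N_def X_def)
    ultimately have "a \<le> c" using D(7)[OF a(1) c(1)] by (simp add: inf_shunt)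
    then have "a \<le> b" using c(2) by simp
    then show False using a(2) by (simp add: inf_shunt)
  qed
  have "\<exists>b'. (\<forall>n. x n \<le> b' \<and> inf b' (y n) = bot) \<and> (\<forall>c\<in>P. inf c b' \<noteq> bot) \<and> (\<forall>c\<in>N. inf c (- b') \<noteq> bot)"
    using sat[unfolded saturated_def, rule_format, of x y P N] x(1) y(1) xy cnt tP Py Nx by blast
  then obtain b' where b': "\<And>n. x n \<le> b'" "\<And>n. inf b' (y n) = bot"
    "\<And>c. c \<in> P \<Longrightarrow> inf c b' \<noteq> bot" "\<And>c. c \<in> N \<Longrightarrow> inf c (- b') \<noteq> bot" by blast
  have pos: "inf a b = bot \<longleftrightarrow> inf a' b' = bot" if "(a, a') \<in> R" for a a'
  proof
    assume "inf a b = bot"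
    then have "a' \<in> Y" using that by (auto simp: Y_def)
    then obtain n where "a' \<le> y n" using y(3) by blast
    then have "inf a' b' \<le> inf b' (y n)" by (simp add: le_infI1)
    then show "inf a' b' = bot" using b'(2) by (simp add: bot_unique)
  next
    assume "inf a' b' = bot"
    then have "a' \<notin> P" using b'(3) by blast
    then show "inf a b = bot" using that by (auto simp: P_def)
  qed
  have neg: "inf a (- b) = bot \<longleftrightarrow> inf a' (- b') = bot" if "(a, a') \<in> R" for a a'
  proof
    assume "inf a (- b) = bot"
    then have "a' \<in> X" using that by (auto simp: X_def inf_shunt)
    then obtain n where "a' \<le> x n" using x(3) by blast
    then show "inf a' (- b') = bot" using b'(1)[of n] by (simp add: inf_shunt)
  next
    assume "inf a' (- b') = bot"
    then have "a' \<notin> N" using b'(4) by blast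
    then show "inf a (- b) = bot" using that by (auto simp: N_def)
  qed
  \<comment> \<open>A piecewise element vanishes exactly when both its pieces do, and
    \<open>pos\<close> and \<open>neg\<close> treat one piece each.\<close>
  have pos2: "(comb b a c = bot) = (comb b' a' c' = bot)" if "(a, a') \<in> R" "(c, c') \<in> R" for a a' c c'
    using pos[OF that(1)] neg[OF that(2)] by (simp add: comb_def sup_eq_bot_iff)
  define R' where "R' = {(comb b a c, comb b' a' c') |a a' c c'. (a, a') \<in> R \<and> (c, c') \<in> R}"
  have R'I: "(comb b a c, comb b' a' c') \<in> R'" if "(a, a') \<in> R" "(c, c') \<in> R" for a a' c c'
    using that by (auto simp: R'_def)
  have "partial_iso R'"
    unfolding partial_iso_def
  proof (intro conjI)
    show "(bot, bot) \<in> R'" using R'I[OF D(1) D(1)] by (simp add: comb_def)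
    show "\<forall>(x, y)\<in>R'. (- x, - y) \<in> R'"
      using R'I[OF D(2) D(2)] by (auto simp: R'_def comb_compl)
    show "\<forall>(x, y)\<in>R'. \<forall>(z, w)\<in>R'. (inf x z, inf y w) \<in> R'"
      using R'I[OF D(3) D(3)] by (fastforce simp: R'_def comb_inf)
    show "\<forall>(x, y)\<in>R'. x = bot \<longleftrightarrow> y = bot" using pos2 by (auto simp: R'_def)
  qed
  moreover have "countable R'"
  proof -
    have "R' = (\<lambda>((a, a'), (c, c')). (comb b a c, comb b' a' c')) ` (R \<times> R)"
      by (force simp: R'_def)
    then show ?thesis using R(2) by simp
  qed
  moreover have "R \<subseteq> R'"
  proof (clarify)
    fix a a' assume "(a, a') \<in> R"
    then show "(a, a') \<in> R'" using R'I[of a a' a a'] by (simp add: comb_same)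
  qed
  moreover have "b \<in> Domain R'" using R'I[OF D(6) D(1)] by (auto simp: comb_def)
  ultimately show ?thesis by (rule that)
qed (use that R in blast)

text \<open>Transfinite recursion along \<open>lt\<close>: stage \<open>i\<close> puts
  \<open>p i\<close> into the domain and \<open>p' i\<close> into the range. Countable initial
  segments keep the union of the earlier stages countable, so the extension lemma applies at every
  stage.\<close>

lemma back_and_forth:
  fixes lt :: "'i rel" and p :: "'i \<Rightarrow> 'a::boolean_algebra" and p' :: "'i \<Rightarrow> 'b::boolean_algebra"
  assumes sat: "saturated TYPE('a)" "saturated TYPE('b)"
    and top_ne: "(top :: 'a) \<noteq> bot" "(top :: 'b) \<noteq> bot"
    and wf: "wf lt" and total: "\<And>i j. i = j \<or> (i, j) \<in> lt \<or> (j, i) \<in> lt"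
    and countable_below: "\<And>i. countable {j. (j, i) \<in> lt}"
    and surj: "surj p" "surj p'"
  obtains f :: "'a \<Rightarrow> 'b" where "boolean_algebra_iso f"
proof -
  \<comment> \<open>The starting relation matters at the least index, where there are no earlier
    stages and an empty union would not contain \<open>(bot, bot)\<close>.\<close>
  define base :: "('a \<times> 'b) set" where "base = {(bot, bot), (top, top)}"
  have base: "partial_iso base" using top_ne by (auto simp: partial_iso_def base_def)
  define good where "good i Q R \<longleftrightarrow> partial_iso R \<and> countable R \<and> Q \<subseteq> R \<and>
      p i \<in> Domain R \<and> p' i \<in> Range R" for i Q R
  have good_ex: "\<exists>R. good i Q R" if Q: "partial_iso Q" "countable Q" for i Q
  proof -
    obtain R where R: "partial_iso R" "countable R" "Q \<subseteq> R" "p i \<in> Domain R"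
      using partial_iso_extend[OF sat(2) Q] .
    have "countable (R\<inverse>)" using countable_image[OF R(2), of prod.swap] by (simp add: image_swap_eq_converse)
    \<comment> \<open>The back step is the forth step applied to the converse relation.\<close>
    obtain S where S: "partial_iso S" "countable S" "R\<inverse> \<subseteq> S" "p' i \<in> Domain S"
      using partial_iso_extend[OF sat(1) partial_iso_converse[OF R(1)] \<open>countable (R\<inverse>)\<close>] .
    have "countable (S\<inverse>)" using countable_image[OF S(2), of prod.swap] by (simp add: image_swap_eq_converse)
    moreover have RS: "R \<subseteq> S\<inverse>" using S(3) by auto
    moreover have "p i \<in> Domain (S\<inverse>)" "p' i \<in> Range (S\<inverse>)"
      using R(4) S(4) Domain_mono[OF RS] by (auto simp: Range_converse)
    ultimately have "good i Q (S\<inverse>)"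
      using R(3) partial_iso_converse[OF S(1)] unfolding good_def by simp
    then show ?thesis ..
  qed
  define step where "step r i = (SOME R. good i (base \<union> (\<Union>j\<in>{j. (j, i) \<in> lt}. r j)) R)" for r i
  define r where "r = wfrec lt step"
  have r: "r i = step r i" for i
  proof -
    \<comment> \<open>\<open>step\<close> consults \<open>r\<close> only below \<open>i\<close>, so
      cutting \<open>r\<close> off there does not change its value.\<close>
    have "r i = step (cut r lt i) i" unfolding r_def by (rule wfrec[OF wf])
    also have "\<dots> = step r i" by (simp add: step_def cut_apply)
    finally show ?thesis .
  qed
  have good: "good i (base \<union> (\<Union>j\<in>{j. (j, i) \<in> lt}. r j)) (r i)" for i
    using wf
  proof (induction i)
    case (less i)
    let ?F = "insert base (r ` {j. (j, i) \<in> lt})"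
    have sub: "r k \<subseteq> r j" if "(k, j) \<in> lt" "(j, i) \<in> lt" for j k
      using less[OF that(2)] that(1) unfolding good_def by blast
    have "partial_iso (\<Union>?F)"
    proof (rule partial_iso_Union)
      show "partial_iso R" if "R \<in> ?F" for R
        using that base less unfolding good_def by blast
      have base_sub: "base \<subseteq> R" if "R \<in> ?F" for R using that less unfolding good_def by blast
      have comparable: "r j \<subseteq> r k \<or> r k \<subseteq> r j" if "(j, i) \<in> lt" "(k, i) \<in> lt" for j k
        using total[of j k] sub[OF _ that(1)] sub[OF _ that(2)] by blast
      show "R \<subseteq> S \<or> S \<subseteq> R" if RS: "R \<in> ?F" "S \<in> ?F" for R S
      proof (cases "R = base \<or> S = base")
        case True
        then show ?thesis using base_sub RS by auto
      next
        case False
        then obtain j k where "(j, i) \<in> lt" "R = r j" "(k, i) \<in> lt" "S = r k" using RS by blast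
        then show ?thesis using comparable by simp
      qed
    qed simp
    moreover have "countable (\<Union>?F)"
      using countable_below[of i] less unfolding good_def by (auto simp: base_def)
    ultimately have "\<exists>R. good i (\<Union>?F) R" by (rule good_ex)
    moreover have "\<Union>?F = base \<union> (\<Union>j\<in>{j. (j, i) \<in> lt}. r j)" by auto
    ultimately show ?case unfolding r[of i] step_def by (metis someI_ex)
  qed
  define T where "T = \<Union>(range r)"
  have T: "partial_iso T"
    unfolding T_def
  proof (rule partial_iso_Union)
    show "partial_iso R" if "R \<in> range r" for R using that good unfolding good_def by blast
    have "r j \<subseteq> r k" if "(j, k) \<in> lt" for j k using good[of k] that unfolding good_def by blast
    then have "r j \<subseteq> r k \<or> r k \<subseteq> r j" for j k using total[of j k] by blast
    then show "R \<subseteq> S \<or> S \<subseteq> R" if "R \<in> range r" "S \<in> range r" for R S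
      using that by blast
  qed simp
  note D = partial_isoD[OF T]
  have dom: "\<exists>b. (a, b) \<in> T" for a
  proof -
    obtain i where "p i = a" using surj(1) by (metis surjD)
    then show ?thesis using good[of i] unfolding good_def T_def by blast
  qed
  have ran: "\<exists>a. (a, b) \<in> T" for b
  proof -
    obtain i where "p' i = b" using surj(2) by (metis surjD)
    then show ?thesis using good[of i] unfolding good_def T_def by blast
  qed
  obtain f where f: "\<And>a. (a, f a) \<in> T" using dom by metis
  have single: "b = c" if "(a, b) \<in> T" "(a, c) \<in> T" for a b c
    using D(7)[OF that] D(7)[OF that(2,1)] by (intro order.antisym) auto
  have eq: "f a = b" if "(a, b) \<in> T" for a b using single[OF f that] .
  have "inj f"
  proof (rule injI)
    fix a c assume "f a = f c"
    then show "a = c" using D(7)[OF f f, of a c] D(7)[OF f f, of c a] by (intro order.antisym) auto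
  qed
  moreover have "surj f" using ran eq by (metis surjI surj_def)
  ultimately have "bij f" by (simp add: bij_def)
  then have "boolean_algebra_iso f"
    unfolding boolean_algebra_iso_def
    using eq[OF D(3)[OF f f]] eq[OF D(4)[OF f f]] eq[OF D(2)[OF f]] eq[OF D(1)] eq[OF D(6)] by simp
  then show ?thesis by (rule that)
qed

section \<open>Saturation of the two quotient algebras\<close>

text \<open>In a well-order whose type is the cardinal of the continuum, every proper initial
  segment has smaller cardinality. Under \<open>CH\<close> this means less than the successor of
  aleph zero, hence countable.\<close>

lemma CH_wellorder:
  assumes CH
  obtains lt :: "nat set rel" where "wf lt" "\<And>i j. i = j \<or> (i, j) \<in> lt \<or> (j, i) \<in> lt"
    "\<And>i. countable {j. (j, i) \<in> lt}"
proof -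
  define r where "r = card_of (UNIV :: nat set set)"
  have field: "Field r = UNIV" using Field_card_of[of "UNIV :: nat set set"] by (simp add: r_def)
  have "well_order_on UNIV r"
    unfolding r_def by (rule card_of_well_order_on)
  then have lin: "linear_order_on UNIV r" and wf: "wf (r - Id)"
    by (simp_all add: well_order_on_def)
  have "countable {j. (j, i) \<in> r - Id}" for i
  proof -
    have "(card_of (underS r i), r) \<in> ordLess"
      using card_of_underS[OF card_of_Card_order, of i "UNIV :: nat set set"] field
      unfolding r_def by simp
    then have "(card_of (underS r i), cardSuc natLeq) \<in> ordLess"
      using ordLess_ordIso_trans \<open>CH\<close> unfolding CH_def r_def by blast
    then have "(card_of (underS r i), natLeq) \<in> ordLeq"
      using cardSuc_ordLeq_ordLess[OF natLeq_Card_order card_of_Card_order] by blast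
    then have "(card_of (underS r i), card_of (UNIV :: nat set)) \<in> ordLeq"
      using ordLeq_ordIso_trans ordIso_symmetric[OF card_of_nat] by blast
    then have "\<exists>g. inj_on g (underS r i) \<and> g ` underS r i \<subseteq> (UNIV :: nat set)"
      by (rule iffD2[OF card_of_ordLeq])
    then obtain g :: "nat set \<Rightarrow> nat" where "inj_on g (underS r i)" by blast
    then have "countable (underS r i)" by (rule countableI)
    moreover have "{j. (j, i) \<in> r - Id} = underS r i" by (auto simp: underS_def)
    ultimately show ?thesis by simp
  qed
  moreover have "i = j \<or> (i, j) \<in> r - Id \<or> (j, i) \<in> r - Id" for i j
    using lin unfolding linear_order_on_def total_on_def by blast
  ultimately show ?thesis by (intro that[OF wf])
qed

lemma abs_B1_eq_bot_iff: "abs_B1 A = bot \<longleftrightarrow> finite A"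
  by (simp add: bot_B1_def B1.abs_eq_iff eq_mod_def Fin_def)

lemma abs_B2_eq_bot_iff: "abs_B2 A = bot \<longleftrightarrow> A \<in> no_inf_antichain"
  by (simp add: bot_B2_def B2.abs_eq_iff eq_mod_def)

lemma abs_B1_rep: "abs_B1 (rep_B1 x) = x"
  by (rule Quotient_abs_rep[OF Quotient_B1])

lemma abs_B2_rep: "abs_B2 (rep_B2 x) = x"
  by (rule Quotient_abs_rep[OF Quotient_B2])

lemma saturated_B1: "saturated TYPE(B1)"
proof (rule saturated_quotient[where q = abs_B1 and J = Fin and L = "\<lambda>n F. n \<le> card F"])
  show "\<exists>A. abs_B1 A = b" for b using abs_B1_rep by blast
  show "\<exists>F\<subseteq>A. finite F \<and> n \<le> card F" if "A \<notin> Fin" for A n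
    using infinite_arbitrarily_large[of A n] that by (auto simp: Fin_def)
  show "A \<notin> Fin" if *: "\<And>n. \<exists>k\<ge>n. \<exists>F\<subseteq>A. k \<le> card F" for A
  proof
    assume "A \<in> Fin"
    then have A: "finite A" by (simp add: Fin_def)
    obtain k F where "k \<ge> Suc (card A)" "F \<subseteq> A" "k \<le> card F" using *[of "Suc (card A)"] by blast
    then show False using card_mono[OF A, of F] by simp
  qed
  show "abs_B1 A = bot \<longleftrightarrow> A \<in> Fin" "finite A \<Longrightarrow> A \<in> Fin" for A
    by (simp_all add: abs_B1_eq_bot_iff Fin_def)
qed (simp_all add: set_ideal_Fin inf_B1.abs_eq uminus_B1.abs_eq)

section \<open>Finite and infinite antichains in the binary tree\<close>

definition wide :: "word_tree set \<Rightarrow> bool" where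
  "wide B \<longleftrightarrow> (\<forall>n. \<exists>A\<subseteq>B. finite A \<and> n \<le> card A \<and> pairwise (\<parallel>) A)"

text \<open>An antichain in a union splits into an antichain on each side, so bounds on the two
  sides add up. This lets wideness be pursued into a single cone of the tree.\<close>

lemma wide_Un:
  assumes "wide (A \<union> B)"
  shows "wide A \<or> wide B"
proof (rule ccontr)
  assume "\<not> (wide A \<or> wide B)"
  then obtain m n where m: "\<And>C. C \<subseteq> A \<Longrightarrow> finite C \<Longrightarrow> pairwise (\<parallel>) C \<Longrightarrow> card C < m"
    and n: "\<And>C. C \<subseteq> B \<Longrightarrow> finite C \<Longrightarrow> pairwise (\<parallel>) C \<Longrightarrow> card C < n"
    unfolding wide_def by (meson not_le)
  obtain C where C: "C \<subseteq> A \<union> B" "finite C" "m + n \<le> card C" "pairwise (\<parallel>) C"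
    using assms unfolding wide_def by blast
  have "card (C \<inter> A) < m" "card (C \<inter> B) < n"
    using C pairwise_subset[OF C(4)] by (auto intro: m n)
  moreover have "card C \<le> card (C \<inter> A) + card (C \<inter> B)"
  proof -
    have "C = C \<inter> A \<union> C \<inter> B" using C(1) by blast
    then show ?thesis using card_Un_le[of "C \<inter> A" "C \<inter> B"] by simp
  qed
  ultimately show False using C(3) by simp
qed

lemma wide_mono: "wide A \<Longrightarrow> A \<subseteq> B \<Longrightarrow> wide B"
  unfolding wide_def by (meson subset_trans)

lemma not_wide_finite: "finite A \<Longrightarrow> \<not> wide A"
proof
  assume A: "finite A" and "wide A"
  then obtain C where "C \<subseteq> A" "Suc (card A) \<le> card C" unfolding wide_def by blast
  then show False using card_mono[OF A, of C] by simp
qed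

lemma wide_UN: "finite I \<Longrightarrow> wide (\<Union>i\<in>I. B i) \<Longrightarrow> \<exists>i\<in>I. wide (B i)"
proof (induction I rule: finite_induct)
  case (insert i I)
  then show ?case using wide_Un[of "B i" "\<Union>i\<in>I. B i"] by auto
qed (simp add: not_wide_finite)

instance letter :: finite
proof
  have "(UNIV :: letter set) = {letter.l, letter.r}" using letter.exhaust by auto
  then show "finite (UNIV :: letter set)" by (metis finite.emptyI finite_insert)
qed

lemma finite_words: "finite {w :: word_tree. length w \<le> n}"
  using finite_lists_length_le[of "UNIV :: letter set" n] by simp

text \<open>Take two incomparable words \<open>p\<close>, \<open>q\<close> of \<open>B\<close> above
  \<open>u\<close> and a level beyond both. Only finitely many words are shorter and the level is
  finite, so one cone at that level is still wide. Its root cannot extend both \<open>p\<close> and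
  \<open>q\<close>.\<close>

lemma wide_step:
  assumes "wide {w \<in> B. prefix u w}"
  obtains v w where "prefix u v" "wide {w \<in> B. prefix v w}" "w \<in> B" "prefix u w" "w \<parallel> v"
proof -
  obtain A where A: "A \<subseteq> {w \<in> B. prefix u w}" "finite A" "2 \<le> card A" "pairwise (\<parallel>) A"
    using assms unfolding wide_def by blast
  obtain p q where pq: "p \<in> A" "q \<in> A" "p \<noteq> q"
    using A(3) by (metis card_2_iff' ex_card in_mono)
  have par: "p \<parallel> q" using A(4) pq by (auto simp: pairwise_def)
  \<comment> \<open>Strictly longer than \<open>p\<close> and \<open>q\<close>, so a word of this
    length is a prefix of neither.\<close>
  define L where "L = Suc (max (length p) (length q))"
  define V where "V = {v :: word_tree. length v = L \<and> prefix u v}"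
  have V: "finite V" by (rule finite_subset[OF _ finite_words[of L]]) (auto simp: V_def)
  have uL: "length u < L" using A(1) pq(1) prefix_length_le[of u p] by (auto simp: L_def)
  have "{w \<in> B. prefix u w} \<subseteq> {w. length w \<le> L} \<union> (\<Union>v\<in>V. {w \<in> B. prefix v w})"
  proof
    fix w assume w: "w \<in> {w \<in> B. prefix u w}"
    show "w \<in> {w. length w \<le> L} \<union> (\<Union>v\<in>V. {w \<in> B. prefix v w})"
    proof (cases "length w \<le> L")
      case False
      have "prefix (take L w) w" by (rule take_is_prefix)
      moreover have "prefix u (take L w)"
        using w uL False by (intro prefix_length_prefix[OF _ take_is_prefix]) simp_all
      moreover have "length (take L w) = L" using False by simp
      ultimately have "take L w \<in> V" "prefix (take L w) w" by (simp_all add: V_def)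
      then show ?thesis using w by blast
    qed simp
  qed
  then have "wide ({w. length w \<le> L} \<union> (\<Union>v\<in>V. {w \<in> B. prefix v w}))" by (rule wide_mono[OF assms])
  then have "wide (\<Union>v\<in>V. {w \<in> B. prefix v w})"
    using wide_Un not_wide_finite[OF finite_words[of L]] by blast
  then obtain v where v: "v \<in> V" "wide {w \<in> B. prefix v w}" using wide_UN[OF V] by blast
  have "p \<parallel> v \<or> q \<parallel> v"
  proof (rule ccontr)
    assume neg: "\<not> (p \<parallel> v \<or> q \<parallel> v)"
    have "\<not> prefix v p" "\<not> prefix v q"
      using v(1) by (auto simp: V_def L_def dest!: prefix_length_le)
    then have "prefix p v" "prefix q v" using neg by (auto simp: parallel_def)
    then show False using par prefix_same_cases[of p v q] by (auto simp: parallel_def)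
  qed
  then show ?thesis using that[of v p] that[of v q] v A(1) pq by (auto simp: V_def)
qed

lemma parallel_prefix: "w \<parallel> v \<Longrightarrow> prefix v x \<Longrightarrow> w \<parallel> x"
  by (metis parallel_def prefix_order.trans prefix_same_cases)

text \<open>Iterating \<open>wide_step\<close> yields a descending sequence of wide cones. Each
  chosen word branches off from the next cone, while all later words lie in that cone. This is the
  F_sigma property of the tree ideal.\<close>

lemma wide_imp_infinite_antichain:
  assumes "wide B"
  shows "\<exists>A\<subseteq>B. infinite A \<and> pairwise (\<parallel>) A"
proof -
  \<comment> \<open>In a state, the first component is the root of the current wide cone and the
    second is the word that has just branched off.\<close>
  define T where "T x y \<longleftrightarrow> wide {w \<in> B. prefix (fst y) w} \<and> prefix (fst x) (fst y) \<and>
      snd y \<in> B \<and> prefix (fst x) (snd y) \<and> snd y \<parallel> fst y" for x y :: "word_tree \<times> word_tree"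
  define p where "p = rec_nat ([], []) (\<lambda>_ x. SOME y. T x y)"
  have p_Suc: "p (Suc n) = (SOME y. T (p n) y)" for n by (simp add: p_def)
  have step: "T (p n) (p (Suc n))" if wide_n: "wide {w \<in> B. prefix (fst (p n)) w}" for n
  proof -
    obtain v w where "prefix (fst (p n)) v" "wide {w \<in> B. prefix v w}" "w \<in> B"
      "prefix (fst (p n)) w" "w \<parallel> v"
      using wide_step[OF wide_n] .
    then have "T (p n) (v, w)" by (simp add: T_def)
    then show ?thesis unfolding p_Suc by (rule someI)
  qed
  have wide: "wide {w \<in> B. prefix (fst (p n)) w}" for n
  proof (induction n)
    case 0
    then show ?case using assms by (simp add: p_def)
  next
    case (Suc n)
    then show ?case using step[of n] by (simp add: T_def)
  qed
  have T: "T (p n) (p (Suc n))" for n by (rule step[OF wide])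
  \<comment> \<open>The shift skips the dummy second component of \<open>p 0\<close>.\<close>
  define w where "w n = snd (p (Suc n))" for n
  have chain: "prefix (fst (p m)) (fst (p n))" if "m \<le> n" for m n
    using that
  proof (induction n rule: dec_induct)
    case (step n)
    then show ?case using T[of n] by (auto simp: T_def intro: prefix_order.trans)
  qed simp
  have par: "w m \<parallel> w n" if "m < n" for m n
  proof -
    have "w m \<parallel> fst (p (Suc m))" "prefix (fst (p n)) (w n)"
      using T[of m] T[of n] by (simp_all add: T_def w_def)
    moreover have "prefix (fst (p (Suc m))) (fst (p n))" using that by (intro chain) simp
    ultimately show ?thesis using parallel_prefix prefix_order.trans by blast
  qed
  have par': "w m \<parallel> w n" if "m \<noteq> n" for m n
    using that par[of m n] par[of n m] by (cases m n rule: linorder_cases) (auto simp: parallel_def)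
  have "inj w" using par' unfolding inj_def parallel_def by (metis prefix_order.refl)
  then have "infinite (range w)" using finite_imageD by blast
  moreover have "pairwise (\<parallel>) (range w)"
  proof (rule pairwiseI)
    fix x y assume "x \<in> range w" "y \<in> range w" "x \<noteq> y"
    then obtain m n where "x = w m" "y = w n" "m \<noteq> n" by blast
    then show "x \<parallel> y" using par' by simp
  qed
  moreover have "range w \<subseteq> B" using T by (auto simp: w_def T_def)
  ultimately show ?thesis by blast
qed

text \<open>Largeness of a finite set is the size of an antichain in it; positivity of a set with
  unboundedly large pieces is \<open>wide_imp_infinite_antichain\<close>.\<close>

lemma saturated_B2: "saturated TYPE(B2)"
proof (rule saturated_quotient[where q = abs_B2 and J = no_inf_antichain
      and L = "\<lambda>n F. \<exists>A\<subseteq>F. finite A \<and> n \<le> card A \<and> pairwise (\<parallel>) A"])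
  show "\<exists>A. abs_B2 A = b" for b using abs_B2_rep by blast
  show "F \<in> no_inf_antichain" if "finite F" for F
    using that by (auto simp: no_inf_antichain_def dest: finite_subset)
  show "\<exists>F\<subseteq>A. finite F \<and> (\<exists>A\<subseteq>F. finite A \<and> n \<le> card A \<and> pairwise (\<parallel>) A)"
    if A: "A \<notin> no_inf_antichain" for A n
  proof -
    obtain C where C: "C \<subseteq> A" "infinite C" "pairwise (\<parallel>) C"
      using A unfolding no_inf_antichain_def by blast
    obtain F where F: "finite F" "card F = n" "F \<subseteq> C" using infinite_arbitrarily_large[OF C(2)] by blast
    then have "pairwise (\<parallel>) F" using pairwise_subset[OF C(3)] by blast
    then show ?thesis using F C(1) by (intro exI[of _ F]) auto
  qed
  show "A \<notin> no_inf_antichain"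
    if *: "\<And>n. \<exists>k\<ge>n. \<exists>F\<subseteq>A. \<exists>C\<subseteq>F. finite C \<and> k \<le> card C \<and> pairwise (\<parallel>) C" for A
  proof -
    have "wide A" unfolding wide_def using * by (meson le_trans subset_trans)
    then show ?thesis using wide_imp_infinite_antichain by (simp add: no_inf_antichain_def)
  qed
qed (simp_all add: set_ideal_no_inf_antichain inf_B2.abs_eq uminus_B2.abs_eq abs_B2_eq_bot_iff)

section \<open>Columns of the plane inside the binary tree\<close>

definition spine :: "nat \<times> nat \<Rightarrow> word_tree" where
  "spine = (\<lambda>(n, v). replicate n letter.l @ replicate (Suc v) letter.r)"

text \<open>Each word has at least one \<open>r\<close>, because of the \<open>Suc\<close> in
  \<open>spine\<close>: a word consisting of \<open>n\<close> letters \<open>l\<close> alone would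
  be a prefix of all later columns. Hence columns are chains and different columns are
  incomparable.\<close>

lemma prefix_spine_iff: "prefix (spine (n, v)) (spine (m, w)) \<longleftrightarrow> n = m \<and> v \<le> w"
proof (induction n arbitrary: m)
  case 0
  then show ?case
  proof (cases m)
    case 0
    have "prefix (replicate a x) (replicate b x) \<longleftrightarrow> a \<le> b" for a b and x :: letter
    proof
      assume "prefix (replicate a x) (replicate b x)"
      then show "a \<le> b" by (auto dest: prefix_length_le)
    next
      assume "a \<le> b"
      then have "replicate b x = replicate a x @ replicate (b - a) x"
        by (simp flip: replicate_add)
      then show "prefix (replicate a x) (replicate b x)" by (simp add: prefix_def)
    qed
    then show ?thesis using 0 by (simp add: spine_def)
  qed (simp add: spine_def)
next
  case (Suc n)
  then show ?case by (cases m) (simp_all add: spine_def)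
qed

lemma inj_spine: "inj spine"
proof (rule injI, clarify)
  fix n v m w assume "spine (n, v) = spine (m, w)"
  then show "n = m \<and> v = w"
    using prefix_spine_iff[of n v m w] prefix_spine_iff[of m w n v] by simp
qed

lemma spine_parallel_iff: "spine p \<parallel> spine q \<longleftrightarrow> fst p \<noteq> fst q"
  by (cases p; cases q) (auto simp: parallel_def prefix_spine_iff)

text \<open>An antichain takes at most one point from each column; conversely, one point from each
  of infinitely many columns gives an infinite antichain.\<close>

lemma spine_image_in_ideal_iff: "spine ` X \<in> no_inf_antichain \<longleftrightarrow> finite (fst ` X)"
proof
  assume fin: "finite (fst ` X)"
  have "finite A" if A: "A \<subseteq> spine ` X" "pairwise (\<parallel>) A" for A
  proof -
    obtain Y where Y: "Y \<subseteq> X" "A = spine ` Y" using A(1) by (metis subset_imageE)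
    have "inj_on fst Y"
    proof (rule inj_onI)
      fix p q assume pq: "p \<in> Y" "q \<in> Y" "fst p = fst q"
      then have "\<not> spine p \<parallel> spine q" by (simp add: spine_parallel_iff)
      then have "spine p = spine q" using A(2) pq Y(2) unfolding pairwise_def by blast
      then show "p = q" using inj_spine by (simp add: inj_eq)
    qed
    moreover have "finite (fst ` Y)" using fin Y(1) by (meson finite_subset image_mono)
    ultimately have "finite Y" by (simp add: finite_image_iff)
    then show ?thesis using Y(2) by simp
  qed
  then show "spine ` X \<in> no_inf_antichain" by (auto simp: no_inf_antichain_def)
next
  assume X: "spine ` X \<in> no_inf_antichain"
  show "finite (fst ` X)"
  proof (rule ccontr)
    assume inf: "infinite (fst ` X)"
    define c where "c n = (n, SOME v. (n, v) \<in> X)" for n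
    have c: "c n \<in> X" if "n \<in> fst ` X" for n
      using that unfolding c_def by (metis (mono_tags) imageE prod.collapse someI_ex)
    have "inj (spine \<circ> c)"
      using inj_spine by (auto simp: inj_def c_def)
    then have "infinite ((spine \<circ> c) ` (fst ` X))"
      using inf finite_image_iff[OF inj_on_subset[OF _ subset_UNIV]] by blast
    moreover have "pairwise (\<parallel>) ((spine \<circ> c) ` (fst ` X))"
      by (auto simp: pairwise_def spine_parallel_iff c_def)
    moreover have "(spine \<circ> c) ` (fst ` X) \<subseteq> spine ` X" using c by auto
    ultimately show False using X unfolding no_inf_antichain_def by blast
  qed
qed

section \<open>Category in the Baire space\<close>

definition nbhd :: "nat \<Rightarrow> (nat \<Rightarrow> nat) \<Rightarrow> (nat \<Rightarrow> nat) set" where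
  "nbhd n c = {f. \<forall>i<n. f i = c i}"

text \<open>Cylinders indexed by finite lists form a countable family, so unions over all of them
  fall under \<open>meager_UN\<close>.\<close>

definition pad :: "nat list \<Rightarrow> nat \<Rightarrow> nat" where
  "pad s i = (if i < length s then s ! i else 0)"

abbreviation cyl :: "nat list \<Rightarrow> (nat \<Rightarrow> nat) set" where
  "cyl s \<equiv> nbhd (length s) (pad s)"

lemma nbhd_self [simp]: "c \<in> nbhd n c"
  by (simp add: nbhd_def)

lemma nbhd_mono: "d \<in> nbhd n c \<Longrightarrow> n \<le> m \<Longrightarrow> nbhd m d \<subseteq> nbhd n c"
  by (auto simp: nbhd_def)

lemma nbhd_cyl: "nbhd n c = cyl (map c [0..<n])"
  by (auto simp: nbhd_def pad_def)

lemma nbhd_nested: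
  assumes "f \<in> nbhd n c" "f \<in> nbhd m d"
  shows "nbhd n c \<subseteq> nbhd m d \<or> nbhd m d \<subseteq> nbhd n c"
  using assms by (cases "n \<le> m") (auto simp: nbhd_def)

definition dense_in :: "(nat \<Rightarrow> nat) set \<Rightarrow> (nat \<Rightarrow> nat) set \<Rightarrow> bool" where
  "dense_in A V \<longleftrightarrow> (\<forall>c n. nbhd n c \<subseteq> V \<longrightarrow> A \<inter> nbhd n c \<noteq> {})"

text \<open>The conditions \<open>d \<in> nbhd n c\<close> and \<open>n \<le> m\<close> together
  make \<open>nbhd m d\<close> a subcylinder of \<open>nbhd n c\<close>.\<close>

definition nowhere_dense :: "(nat \<Rightarrow> nat) set \<Rightarrow> bool" where
  "nowhere_dense A \<longleftrightarrow> (\<forall>c n. \<exists>d m. d \<in> nbhd n c \<and> n \<le> m \<and> nbhd m d \<inter> A = {})"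

definition meager :: "(nat \<Rightarrow> nat) set \<Rightarrow> bool" where
  "meager A \<longleftrightarrow> (\<exists>N. (\<forall>i::nat. nowhere_dense (N i)) \<and> A \<subseteq> (\<Union>i. N i))"

definition everywhere_nonmeager :: "(nat \<Rightarrow> nat) set \<Rightarrow> (nat \<Rightarrow> nat) set \<Rightarrow> bool" where
  "everywhere_nonmeager A V \<longleftrightarrow> (\<forall>c n. nbhd n c \<subseteq> V \<longrightarrow> \<not> meager (A \<inter> nbhd n c))"

lemma dense_inD: "dense_in A V \<Longrightarrow> nbhd n c \<subseteq> V \<Longrightarrow> \<exists>f\<in>A. f \<in> nbhd n c"
  unfolding dense_in_def by blast

lemma nowhere_dense_meager: "nowhere_dense A \<Longrightarrow> meager A"
  unfolding meager_def by (rule exI[of _ "\<lambda>_. A"]) auto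

lemma meager_subset: "meager A \<Longrightarrow> B \<subseteq> A \<Longrightarrow> meager B"
  unfolding meager_def by blast

lemma meager_empty [simp]: "meager {}"
  by (rule nowhere_dense_meager) (auto simp: nowhere_dense_def intro: nbhd_self)

lemma meager_UN:
  fixes A :: "'i::countable \<Rightarrow> (nat \<Rightarrow> nat) set"
  assumes "\<And>i. meager (A i)"
  shows "meager (\<Union>i. A i)"
proof -
  obtain N where N: "\<And>i j::nat. nowhere_dense (N i j)" "\<And>i. A i \<subseteq> (\<Union>j. N i j)"
    using assms unfolding meager_def by metis
  define M where "M = (\<lambda>k. case prod_decode k of (a, b) \<Rightarrow> N (from_nat a) b)"
  have "nowhere_dense (M k)" for k
    by (simp add: M_def N split: prod.split)
  moreover have "(\<Union>i. A i) \<subseteq> (\<Union>k. M k)"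
  proof
    fix f assume "f \<in> (\<Union>i. A i)"
    then obtain i j where "f \<in> N i j" using N(2) by blast
    then have "f \<in> M (prod_encode (to_nat i, j))" by (simp add: M_def)
    then show "f \<in> (\<Union>k. M k)" by blast
  qed
  ultimately show ?thesis unfolding meager_def by blast
qed

lemma meager_Un: "meager A \<Longrightarrow> meager B \<Longrightarrow> meager (A \<union> B)"
proof -
  assume "meager A" "meager B"
  then have "meager (\<Union>b::bool. if b then A else B)"
    by (intro meager_UN) simp
  then show ?thesis by (rule meager_subset) (auto split: if_splits)
qed

lemma nonmeager_UN_obtain:
  fixes B :: "'i::countable \<Rightarrow> (nat \<Rightarrow> nat) set"
  assumes "\<not> meager A" "A \<subseteq> (\<Union>i. B i)"
  obtains i where "\<not> meager (A \<inter> B i)"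
proof -
  have "\<not> (\<forall>i. meager (A \<inter> B i))"
  proof
    assume "\<forall>i. meager (A \<inter> B i)"
    then have "meager (\<Union>i. A \<inter> B i)" by (intro meager_UN) auto
    then have "meager A" by (rule meager_subset) (use assms(2) in auto)
    with assms(1) show False ..
  qed
  then show ?thesis using that by blast
qed

lemma baire: "\<not> meager (nbhd n c)"
proof
  assume "meager (nbhd n c)"
  then obtain N where N: "\<And>i::nat. nowhere_dense (N i)" "nbhd n c \<subseteq> (\<Union>i. N i)"
    unfolding meager_def by blast
  have step: "\<exists>d m. d \<in> nbhd k b \<and> k < m \<and> nbhd m d \<inter> N i = {}" for b k i
  proof -
    obtain d m where dm: "d \<in> nbhd k b" "k \<le> m" "nbhd m d \<inter> N i = {}"
      using N(1)[of i] unfolding nowhere_dense_def by blast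
    \<comment> \<open>Lengthening by one makes the lengths strictly increase, so that the nested
      cylinders determine a single function.\<close>
    have "nbhd (Suc m) d \<inter> N i = {}"
      using dm(3) nbhd_mono[of d m d "Suc m"] by auto
    with dm(1,2) show ?thesis by (intro exI[of _ d] exI[of _ "Suc m"]) auto
  qed
  have step': "\<exists>y. snd y \<in> nbhd (fst x) (snd x) \<and> fst x < fst y \<and>
      nbhd (fst y) (snd y) \<inter> N i = {}" for x :: "nat \<times> (nat \<Rightarrow> nat)" and i
  proof -
    obtain d m where "d \<in> nbhd (fst x) (snd x)" "fst x < m" "nbhd m d \<inter> N i = {}"
      using step[where k="fst x" and b="snd x" and i=i] by blast
    then show ?thesis by (intro exI[of _ "(m, d)"]) simp
  qed
  define p where "p = rec_nat (n, c) (\<lambda>i x. SOME y. snd y \<in> nbhd (fst x) (snd x) \<and>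
      fst x < fst y \<and> nbhd (fst y) (snd y) \<inter> N i = {})"
  have p0: "p 0 = (n, c)" by (simp add: p_def)
  have "snd (p (Suc i)) \<in> nbhd (fst (p i)) (snd (p i)) \<and> fst (p i) < fst (p (Suc i)) \<and>
      nbhd (fst (p (Suc i))) (snd (p (Suc i))) \<inter> N i = {}" for i
    using someI_ex[OF step'[where x="p i" and i=i]] by (simp add: p_def)
  then have p: "\<And>i. snd (p (Suc i)) \<in> nbhd (fst (p i)) (snd (p i))"
      "\<And>i. fst (p i) < fst (p (Suc i))"
      "\<And>i. nbhd (fst (p (Suc i))) (snd (p (Suc i))) \<inter> N i = {}"
    by auto
  have sm: "strict_mono (\<lambda>i. fst (p i))" using p(2) by (simp add: strict_mono_Suc_iff)
  have nest: "nbhd (fst (p j)) (snd (p j)) \<subseteq> nbhd (fst (p i)) (snd (p i))" if "i \<le> j" for i j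
    using that
  proof (induction j rule: dec_induct)
    case (step j)
    then show ?case using nbhd_mono[OF p(1)[of j] less_imp_le[OF p(2)[of j]]] by blast
  qed simp
  \<comment> \<open>The cylinder of stage \<open>Suc k\<close> has length greater than
    \<open>k\<close>, so coordinate \<open>k\<close> is settled there.\<close>
  define f where "f k = snd (p (Suc k)) k" for k
  have f: "f \<in> nbhd (fst (p i)) (snd (p i))" for i
    unfolding nbhd_def
  proof safe
    fix k assume k: "k < fst (p i)"
    define J where "J = max i (Suc k)"
    have k': "k < fst (p (Suc k))" using strict_mono_imp_increasing[OF sm, of "Suc k"] by simp
    have "snd (p J) k = snd (p i) k"
      using nest[of i J] k nbhd_self[of "snd (p J)" "fst (p J)"] unfolding J_def nbhd_def by auto
    moreover have "snd (p J) k = snd (p (Suc k)) k"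
      using nest[of "Suc k" J] k' nbhd_self[of "snd (p J)" "fst (p J)"] unfolding J_def nbhd_def by auto
    ultimately show "f k = snd (p i) k" by (simp add: f_def)
  qed
  have "f \<notin> N i" for i using f[of "Suc i"] p(3)[of i] by blast
  moreover have "f \<in> nbhd n c" using f[of 0] p0 by simp
  ultimately show False using N(2) by blast
qed

lemma everywhere_nonmeager_subset:
  "everywhere_nonmeager A V \<Longrightarrow> A \<subseteq> B \<Longrightarrow> W \<subseteq> V \<Longrightarrow> everywhere_nonmeager B W"
  unfolding everywhere_nonmeager_def using meager_subset[OF _ Int_mono[OF _ order_refl]] by blast

lemma everywhere_nonmeager_dense: "everywhere_nonmeager A V \<Longrightarrow> dense_in A V"
  unfolding everywhere_nonmeager_def dense_in_def using meager_empty by fastforce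

text \<open>Banach's category argument: the union \<open>M\<close> of all meager traces of
  \<open>A\<close> on cylinders is meager. If \<open>A\<close> were everywhere nonmeager in no
  cylinder, each neighbourhood would contain one whose trace is absorbed by \<open>M\<close>,
  leaving \<open>A - M\<close> nowhere dense.\<close>

lemma nonmeager_somewhere:
  assumes "\<not> meager A"
  obtains s where "everywhere_nonmeager A (cyl s)"
proof -
  have "\<exists>s. everywhere_nonmeager A (cyl s)"
  proof (rule ccontr)
    assume neg: "\<not> ?thesis"
    define M where "M = (\<Union>s. if meager (A \<inter> cyl s) then A \<inter> cyl s else {})"
    have "meager M" unfolding M_def by (rule meager_UN) simp
    moreover have "nowhere_dense (A - M)"
      unfolding nowhere_dense_def
    proof (intro allI)
      fix c n
      have "\<not> everywhere_nonmeager A (nbhd n c)"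
        using neg nbhd_cyl by metis
      then obtain d m where dm: "nbhd m d \<subseteq> nbhd n c" "meager (A \<inter> nbhd m d)"
        unfolding everywhere_nonmeager_def by blast
      have "A \<inter> cyl (map d [0..<m]) \<subseteq> M"
      proof
        fix f assume "f \<in> A \<inter> cyl (map d [0..<m])"
        then show "f \<in> M"
          using dm(2) nbhd_cyl[of m d] unfolding M_def by (intro UN_I[of "map d [0..<m]"]) simp_all
      qed
      then have "nbhd m d \<inter> (A - M) = {}" using nbhd_cyl[of m d] by blast
      moreover have "nbhd (max n m) d \<subseteq> nbhd m d" by (rule nbhd_mono) auto
      moreover have "d \<in> nbhd n c" using dm(1) nbhd_self by blast
      ultimately show "\<exists>d m. d \<in> nbhd n c \<and> n \<le> m \<and> nbhd m d \<inter> (A - M) = {}"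
        by (intro exI[of _ d] exI[of _ "max n m"]) auto
    qed
    ultimately have "meager (M \<union> (A - M))"
      by (rule meager_Un[OF _ nowhere_dense_meager])
    then have "meager A" by (rule meager_subset) auto
    with assms show False ..
  qed
  then show ?thesis using that by blast
qed

lemma nonmeager_somewhere_in:
  assumes "\<not> meager (A \<inter> nbhd n c)"
  obtains m d where "nbhd m d \<subseteq> nbhd n c" "everywhere_nonmeager A (nbhd m d)"
proof -
  obtain s where s: "everywhere_nonmeager (A \<inter> nbhd n c) (cyl s)"
    using nonmeager_somewhere[OF assms] .
  then have "\<not> meager (A \<inter> nbhd n c \<inter> cyl s)"
    unfolding everywhere_nonmeager_def by blast
  then have "A \<inter> nbhd n c \<inter> cyl s \<noteq> {}" using meager_empty by metis
  then obtain f where "f \<in> nbhd n c" "f \<in> cyl s" by blast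
  then consider "cyl s \<subseteq> nbhd n c" | "nbhd n c \<subseteq> cyl s" using nbhd_nested by blast
  then show ?thesis
  proof cases
    case 1
    then show ?thesis using that everywhere_nonmeager_subset[OF s] by blast
  next
    case 2
    then show ?thesis using that[of n c] everywhere_nonmeager_subset[OF s, of A "nbhd n c"] by blast
  qed
qed

text \<open>A nonmeager exceptional set would be everywhere nonmeager in some cylinder; then so
  would \<open>A\<close>, and no exceptional point could lie in that cylinder.\<close>

lemma meager_outside_nonmeager_part:
  "meager {f \<in> A. \<not> (\<exists>s. f \<in> cyl s \<and> everywhere_nonmeager A (cyl s))}" (is "meager ?N")
proof (rule ccontr)
  assume "\<not> meager ?N"
  then obtain s where s: "everywhere_nonmeager ?N (cyl s)" by (rule nonmeager_somewhere)
  then have "everywhere_nonmeager A (cyl s)" by (rule everywhere_nonmeager_subset) auto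
  then have "?N \<inter> cyl s = {}" by blast
  with s show False unfolding everywhere_nonmeager_def using meager_empty by fastforce
qed

section \<open>Products and the Kuratowski-Ulam theorem\<close>

definition mix :: "nat set \<Rightarrow> (nat \<Rightarrow> 'a) \<Rightarrow> (nat \<Rightarrow> 'a) \<Rightarrow> nat \<Rightarrow> 'a" where
  "mix J f h i = (if i \<in> J then f i else h i)"

text \<open>\<open>mix J\<close> presents the Baire space as the product of its restrictions to
  \<open>J\<close> and to the complement. A cylinder around a point \<open>q\<close> that misses
  \<open>N\<close> is a box: its \<open>J\<close> side restricts \<open>f\<close>, and its other
  side provides the cylinder for \<open>h\<close>.\<close>

lemma nowhere_dense_sections:
  assumes "nowhere_dense N"
  shows "nowhere_dense {f. \<not> (\<exists>d m. d \<in> nbhd n c \<and> n \<le> m \<and> (\<forall>h\<in>nbhd m d. mix J f h \<notin> N))}"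
  unfolding nowhere_dense_def
proof (intro allI)
  fix u k
  define L where "L = max n k"
  obtain q K where q: "q \<in> nbhd L (mix J u c)" "L \<le> K" "nbhd K q \<inter> N = {}"
    using assms unfolding nowhere_dense_def by blast
  have "mix J f h \<notin> N" if "f \<in> nbhd K (mix J q u)" "h \<in> nbhd K (mix J c q)" for f h
  proof -
    have "mix J f h \<in> nbhd K q" using that by (auto simp: nbhd_def mix_def)
    then show ?thesis using q(3) by blast
  qed
  moreover have "mix J c q \<in> nbhd n c" "n \<le> K" "mix J q u \<in> nbhd k u" "k \<le> K"
    using q(1,2) by (auto simp: nbhd_def mix_def L_def)
  ultimately show "\<exists>d m. d \<in> nbhd k u \<and> k \<le> m \<and>
      nbhd m d \<inter> {f. \<not> (\<exists>d m. d \<in> nbhd n c \<and> n \<le> m \<and> (\<forall>h\<in>nbhd m d. mix J f h \<notin> N))} = {}"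
    by (intro exI[of _ "mix J q u"] exI[of _ K]) blast
qed

text \<open>There are countably many pairs of a nowhere dense set and a cylinder. Outside the meager
  union of their exceptional sets, every section is a countable union of nowhere dense sets.\<close>

lemma kuratowski_ulam:
  assumes "meager M"
  shows "meager {f. \<not> meager {h. mix J f h \<in> M}}"
proof -
  obtain N where N: "\<And>i::nat. nowhere_dense (N i)" "M \<subseteq> (\<Union>i. N i)"
    using assms unfolding meager_def by blast
  define X where "X i s = {f. \<not> (\<exists>d m. d \<in> cyl s \<and> length s \<le> m \<and> (\<forall>h\<in>nbhd m d. mix J f h \<notin> N i))}"
    for i s
  have "meager (X i s)" for i s
    unfolding X_def by (rule nowhere_dense_meager[OF nowhere_dense_sections[OF N(1)]])
  then have "meager (\<Union>(i, s). X i s)"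
    by (intro meager_UN) (simp split: prod.split)
  moreover have "meager {h. mix J f h \<in> M}" if f: "f \<notin> (\<Union>(i, s). X i s)" for f
  proof -
    have "nowhere_dense {h. mix J f h \<in> N i}" for i
      unfolding nowhere_dense_def
    proof (intro allI)
      fix c n
      have "f \<notin> X i (map c [0..<n])" using f by auto
      then show "\<exists>d m. d \<in> nbhd n c \<and> n \<le> m \<and> nbhd m d \<inter> {h. mix J f h \<in> N i} = {}"
        unfolding X_def nbhd_cyl[of n c, symmetric] by auto
    qed
    then have "meager (\<Union>i. {h. mix J f h \<in> N i})"
      by (intro meager_UN nowhere_dense_meager)
    then show ?thesis by (rule meager_subset) (use N(2) in auto)
  qed
  ultimately show ?thesis by (elim meager_subset) auto
qed

section \<open>Piecewise continuous liftings\<close>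

lemma uncountable_fibre:
  fixes g :: "'a \<Rightarrow> 'b::countable"
  assumes "uncountable A"
  obtains b where "uncountable {a \<in> A. g a = b}"
proof -
  have "A = (\<Union>b. {a \<in> A. g a = b})" by auto
  then have "\<not> (\<forall>b. countable {a \<in> A. g a = b})"
    using assms countable_UN[of UNIV "\<lambda>b. {a \<in> A. g a = b}"] by auto
  then show ?thesis using that by blast
qed

lemma uncountable_not_inj_on:
  fixes g :: "'a \<Rightarrow> 'b::countable"
  assumes "uncountable A"
  obtains a b where "a \<in> A" "b \<in> A" "a \<noteq> b" "g a = g b"
  using assms countableI'[of g A] unfolding inj_on_def by blast

lemma uncountable_cantor_space: "uncountable (UNIV :: (nat \<Rightarrow> bool) set)"
proof
  assume "countable (UNIV :: (nat \<Rightarrow> bool) set)"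
  then have "\<exists>g :: nat \<Rightarrow> nat \<Rightarrow> bool. range g = UNIV"
    using uncountable_def[of "UNIV :: (nat \<Rightarrow> bool) set"] by auto
  then obtain g :: "nat \<Rightarrow> nat \<Rightarrow> bool" where g: "range g = UNIV" ..
  have "(\<lambda>n. \<not> g n n) \<in> range g" unfolding g by simp
  then obtain n where "g n = (\<lambda>n. \<not> g n n)" by (metis imageE)
  then show False by (metis (full_types))
qed

text \<open>A cylinder fixes finitely many coordinates, while \<open>j n\<close> is unbounded on
  \<open>N\<close>, so another hit can always be forced; functions without hits from index
  \<open>b\<close> on are therefore nowhere dense.\<close>

lemma meager_finite_hits:
  fixes j v :: "nat \<Rightarrow> nat"
  assumes N: "infinite N" and j: "inj j"
  shows "meager {f. finite {n \<in> N. f (j n) = v n}}"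
proof -
  define X where "X b = {f. \<forall>n\<in>N. b \<le> n \<longrightarrow> f (j n) \<noteq> v n}" for b
  have "nowhere_dense (X b)" for b
    unfolding nowhere_dense_def
  proof (intro allI)
    fix c m
    have "infinite (j ` (N - {..<b}))"
      using N j by (simp add: finite_image_iff inj_on_def)
    then obtain l where "m \<le> l" "l \<in> j ` (N - {..<b})"
      using infinite_nat_iff_unbounded_le by blast
    then obtain n where n: "n \<in> N" "b \<le> n" "m \<le> j n"
      by (auto simp flip: not_less)
    have "c(j n := v n) \<in> nbhd m c" using n by (auto simp: nbhd_def)
    moreover have "nbhd (Suc (j n)) (c(j n := v n)) \<inter> X b = {}"
      using n by (auto simp: nbhd_def X_def)
    ultimately show "\<exists>d m'. d \<in> nbhd m c \<and> m \<le> m' \<and> nbhd m' d \<inter> X b = {}"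
      using n by (intro exI[of _ "c(j n := v n)"] exI[of _ "Suc (j n)"]) auto
  qed
  then have "meager (\<Union>b. X b)" by (intro meager_UN nowhere_dense_meager)
  moreover have "{f. finite {n \<in> N. f (j n) = v n}} \<subseteq> (\<Union>b. X b)"
  proof
    fix f assume "f \<in> {f. finite {n \<in> N. f (j n) = v n}}"
    then obtain b where "\<forall>n\<in>{n \<in> N. f (j n) = v n}. n < b"
      using finite_nat_set_iff_bounded by auto
    then have "f \<in> X b" unfolding X_def by force
    then show "f \<in> (\<Union>b. X b)" by blast
  qed
  ultimately show ?thesis by (rule meager_subset)
qed

lemma nonmeager_infinite_hits:
  fixes j v :: "nat \<Rightarrow> nat"
  assumes "\<not> meager A" "infinite N" "inj j"
  obtains f where "f \<in> A" "infinite {n \<in> N. f (j n) = v n}"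
proof -
  have "\<not> A \<subseteq> {f. finite {n \<in> N. f (j n) = v n}}"
    using assms(1) meager_subset[OF meager_finite_hits[OF assms(2,3)]] by blast
  then show ?thesis using that by blast
qed

text \<open>The numbers \<open>branch z n\<close> code the nodes of the binary tree along
  \<open>z\<close>, so the ranges form an almost disjoint family indexed by the Cantor
  space.\<close>

definition branch :: "(nat \<Rightarrow> bool) \<Rightarrow> nat \<Rightarrow> nat" where
  "branch z n = to_nat (map z [0..<n])"

lemma branch_eq_iff: "branch z m = branch y n \<longleftrightarrow> m = n \<and> (\<forall>i<n. z i = y i)"
proof -
  have "map z [0..<m] = map y [0..<n] \<longleftrightarrow> m = n \<and> (\<forall>i<n. z i = y i)"
    by (auto dest: map_eq_imp_length_eq simp: list_eq_iff_nth_eq)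
  then show ?thesis by (simp add: branch_def)
qed

lemma inj_branch: "inj (branch z)"
  by (auto simp: inj_def branch_eq_iff)

lemma finite_branch_Int:
  assumes "y \<noteq> z"
  shows "finite (range (branch y) \<inter> range (branch z))"
proof -
  obtain p where p: "y p \<noteq> z p" using assms by blast
  have "range (branch y) \<inter> range (branch z) \<subseteq> branch y ` {..p}"
  proof
    fix a assume "a \<in> range (branch y) \<inter> range (branch z)"
    then obtain n where n: "a = branch y n" "\<forall>i<n. y i = z i" by (auto simp: branch_eq_iff)
    then have "n \<le> p" using p by (metis not_le)
    then show "a \<in> branch y ` {..p}" using n(1) by blast
  qed
  then show ?thesis by (rule finite_subset) simp
qed

text \<open>
  \<open>\<Phi> f\<close> stands for the image of the graph of \<open>f\<close> and \<open>\<epsilon> J\<close> for the image of the set of all points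
  in the columns \<open>J\<close>, both under the lifted embedding.
\<close>

locale covered_lifting =
  fixes \<Phi> :: "(nat \<Rightarrow> nat) \<Rightarrow> nat set" and \<epsilon> :: "nat set \<Rightarrow> nat set"
    and H :: "nat \<Rightarrow> (nat \<Rightarrow> nat) set"
  assumes cover: "(\<Union>k. H k) = UNIV"
    and continuous_on_piece: "dense_in (H k) (nbhd n c) \<Longrightarrow>
      \<exists>d. \<forall>f\<in>H k \<inter> nbhd n c. \<forall>f'\<in>H k \<inter> nbhd n c.
        (\<forall>j<d. f j = f' j) \<longrightarrow> (\<forall>q<i. q \<in> \<Phi> f \<longleftrightarrow> q \<in> \<Phi> f')"
    and support_cofinite: "finite (- (J \<union> J')) \<Longrightarrow> finite (\<epsilon> UNIV - (\<epsilon> J \<union> \<epsilon> J'))"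
    and support_mono: "J \<subseteq> J' \<Longrightarrow> finite (\<epsilon> J - \<epsilon> J')"
    and lifting_subset: "\<Phi> f \<subseteq> \<epsilon> UNIV"
    and lifting_local: "(\<And>j. j \<in> J \<Longrightarrow> f j = f' j) \<Longrightarrow> finite (sym_diff (\<Phi> f) (\<Phi> f') \<inter> \<epsilon> J)"
    and lifting_disjoint: "(\<And>j. j \<in> J \<Longrightarrow> f j \<noteq> f' j) \<Longrightarrow> finite (\<Phi> f \<inter> \<Phi> f' \<inter> \<epsilon> J)"
    and lifting_infinite: "infinite J \<Longrightarrow> infinite (\<Phi> f \<inter> \<epsilon> J)"
begin

text \<open>
  For generic \<open>f\<close>, almost every \<open>h\<close> puts \<open>mix J f h\<close> into a nonmeager piece \<open>H k\<close>, where \<open>\<Phi>\<close> is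
  continuous. Fixing the piece and the finite error on a nonmeager set of \<open>f\<close> makes \<open>\<Phi> f\<close> on \<open>\<epsilon> J\<close> a
  continuous function of the restriction of \<open>f\<close> to \<open>J\<close>.
\<close>

lemma localize_on_piece:
  assumes H: "everywhere_nonmeager (H k0) V" and t: "nbhd nt t \<subseteq> V" and Vs: "V = nbhd ns s"
  obtains n' t' m where "nbhd n' t' \<subseteq> nbhd nt t"
    "\<And>i. \<exists>d. \<forall>f\<in>H k0 \<inter> nbhd n' t'. \<forall>f'\<in>H k0 \<inter> nbhd n' t'.
       (\<forall>j<d. j \<in> J \<longrightarrow> f j = f' j) \<longrightarrow>
       (\<forall>q<i. m \<le> q \<and> q \<in> \<epsilon> J \<longrightarrow> (q \<in> \<Phi> f \<longleftrightarrow> q \<in> \<Phi> f'))"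
proof -
  \<comment> \<open>Outside \<open>M\<close>, every piece containing a point is everywhere
    nonmeager, hence dense, in a cylinder around it. There \<open>continuous_on_piece\<close>
    applies.\<close>
  define M where
    "M = (\<Union>k. {f \<in> H k. \<not> (\<exists>s. f \<in> cyl s \<and> everywhere_nonmeager (H k) (cyl s))})"
  have M: "meager M" unfolding M_def by (intro meager_UN meager_outside_nonmeager_part)
  define W where "W = {f. \<not> meager {h. mix J f h \<in> M}}"
  have W: "meager W" unfolding W_def using M by (rule kuratowski_ulam)
  define Q where "Q f k \<sigma> m = {h. mix J f h \<in> H k \<inter> cyl \<sigma> \<and>
      sym_diff (\<Phi> (mix J f h)) (\<Phi> f) \<inter> \<epsilon> J \<subseteq> {..<m::nat}}" for f k \<sigma> m
  \<comment> \<open>A parameter names a piece \<open>k\<close>, a cylinder \<open>\<sigma>\<close>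
    for the mixed point, an error bound \<open>m\<close> and a cylinder \<open>\<rho>\<close> for
    \<open>h\<close>. There are only countably many, so one serves a nonmeager set of
    \<open>f\<close>.\<close>
  define P where "P = (\<lambda>(k, \<sigma>, m, \<rho>). {f. everywhere_nonmeager (H k) (cyl \<sigma>) \<and>
      everywhere_nonmeager (Q f k \<sigma> m) (cyl \<rho>)})"
  have cov: "\<exists>p. f \<in> P p" if f: "f \<notin> W" for f
  proof -
    define Q' where "Q' = (\<lambda>(k, \<sigma>, m). if everywhere_nonmeager (H k) (cyl \<sigma>) then Q f k \<sigma> m else {})"
    have sub: "- {h. mix J f h \<in> M} \<subseteq> (\<Union>p. Q' p)"
    proof
      fix h assume h: "h \<in> - {h. mix J f h \<in> M}"
      obtain k where k: "mix J f h \<in> H k" using cover by blast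
      then obtain \<sigma> where \<sigma>: "mix J f h \<in> cyl \<sigma>" "everywhere_nonmeager (H k) (cyl \<sigma>)"
        using h unfolding M_def by blast
      have "finite (sym_diff (\<Phi> (mix J f h)) (\<Phi> f) \<inter> \<epsilon> J)"
        by (rule lifting_local) (simp add: mix_def)
      then obtain m where "sym_diff (\<Phi> (mix J f h)) (\<Phi> f) \<inter> \<epsilon> J \<subseteq> {..<m}"
        using finite_nat_iff_bounded by blast
      then have "h \<in> Q' (k, \<sigma>, m)" using k \<sigma> by (simp add: Q'_def Q_def)
      then show "h \<in> (\<Union>p. Q' p)" by blast
    qed
    have "\<not> meager (- {h. mix J f h \<in> M})"
    proof
      assume "meager (- {h. mix J f h \<in> M})"
      moreover have "meager {h. mix J f h \<in> M}" using f by (simp add: W_def)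
      ultimately have "meager ({h. mix J f h \<in> M} \<union> - {h. mix J f h \<in> M})"
        by (intro meager_Un)
      then have "meager (nbhd 0 f)" by (rule meager_subset) auto
      then show False using baire by blast
    qed
    then obtain p where "\<not> meager (- {h. mix J f h \<in> M} \<inter> Q' p)"
      using nonmeager_UN_obtain[OF _ sub] by blast
    then have nm: "\<not> meager (Q' p)" using meager_subset by blast
    obtain k \<sigma> m where p: "p = (k, \<sigma>, m)" by (cases p)
    have e: "everywhere_nonmeager (H k) (cyl \<sigma>)" "\<not> meager (Q f k \<sigma> m)"
      using nm unfolding p Q'_def by (auto split: if_splits)
    obtain \<rho> where "everywhere_nonmeager (Q f k \<sigma> m) (cyl \<rho>)"
      using nonmeager_somewhere[OF e(2)] .
    then have "f \<in> P (k, \<sigma>, m, \<rho>)" using e(1) by (simp add: P_def)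
    then show ?thesis ..
  qed
  have "\<not> meager (H k0 \<inter> nbhd nt t)" using H t unfolding everywhere_nonmeager_def by blast
  then have "\<not> meager (H k0 \<inter> nbhd nt t - W)"
    using meager_subset[OF meager_Un[OF _ W], of "H k0 \<inter> nbhd nt t - W" "H k0 \<inter> nbhd nt t"] by blast
  moreover have "H k0 \<inter> nbhd nt t - W \<subseteq> (\<Union>p. P p)" using cov by blast
  ultimately obtain p where "\<not> meager ((H k0 \<inter> nbhd nt t - W) \<inter> P p)"
    by (rule nonmeager_UN_obtain)
  then have "\<not> meager ((H k0 \<inter> P p) \<inter> nbhd nt t)" 
    using meager_subset[of "(H k0 \<inter> P p) \<inter> nbhd nt t" "(H k0 \<inter> nbhd nt t - W) \<inter> P p"] by blast
  then obtain n' t' where t': "nbhd n' t' \<subseteq> nbhd nt t" "everywhere_nonmeager (H k0 \<inter> P p) (nbhd n' t')"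
    by (rule nonmeager_somewhere_in)
  obtain k \<sigma> m \<rho> where p: "p = (k, \<sigma>, m, \<rho>)" by (cases p)
  have dense_P: "dense_in (H k0 \<inter> P p) (nbhd n' t')"
    using t'(2) by (rule everywhere_nonmeager_dense)
  have "H k0 \<inter> P p \<noteq> {}" using dense_inD[OF dense_P order_refl] by blast
  then have Hk: "dense_in (H k) (cyl \<sigma>)" unfolding p P_def by (auto intro: everywhere_nonmeager_dense)
  have H0: "dense_in (H k0) (nbhd ns s)" using H everywhere_nonmeager_dense Vs by blast
  show ?thesis
  proof (rule that[OF t'(1)])
    fix i
    obtain d where d: "\<And>f f' q. f \<in> H k \<Longrightarrow> f \<in> cyl \<sigma> \<Longrightarrow> f' \<in> H k \<Longrightarrow> f' \<in> cyl \<sigma> \<Longrightarrow>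
        (\<forall>j<d. f j = f' j) \<Longrightarrow> q < i \<Longrightarrow> q \<in> \<Phi> f \<longleftrightarrow> q \<in> \<Phi> f'"
      using continuous_on_piece[OF Hk, of i] by blast
    obtain d0 where d0: "\<And>f f' q. f \<in> H k0 \<Longrightarrow> f \<in> V \<Longrightarrow> f' \<in> H k0 \<Longrightarrow> f' \<in> V \<Longrightarrow>
        (\<forall>j<d0. f j = f' j) \<Longrightarrow> q < i \<Longrightarrow> q \<in> \<Phi> f \<longleftrightarrow> q \<in> \<Phi> f'"
      using continuous_on_piece[OF H0, of i] unfolding Vs by blast
    define D where "D = Max {d, d0, n', length \<rho>}"
    have D: "d \<le> D" "d0 \<le> D" "n' \<le> D" "length \<rho> \<le> D" by (auto simp: D_def)
    have "q \<in> \<Phi> f \<longleftrightarrow> q \<in> \<Phi> f'"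
      if f: "f \<in> H k0" "f \<in> nbhd n' t'" and f': "f' \<in> H k0" "f' \<in> nbhd n' t'"
        and eq: "\<forall>j<D. j \<in> J \<longrightarrow> f j = f' j" and q: "q < i" "m \<le> q" "q \<in> \<epsilon> J" for f f' q
    proof -
      \<comment> \<open>Continuity of \<open>\<Phi>\<close> on \<open>H k0\<close> allows replacing
        \<open>f\<close> by a nearby point of the dense set \<open>H k0 \<inter> P p\<close> without
        changing membership of \<open>q\<close>.\<close>
      have approx: "\<exists>g. g \<in> H k0 \<and> g \<in> P p \<and> g \<in> V \<and> (\<forall>j<D. g j = f j) \<and> (q \<in> \<Phi> g \<longleftrightarrow> q \<in> \<Phi> f)"
        if "f \<in> H k0" "f \<in> nbhd n' t'" for f
      proof -
        have "nbhd D f \<subseteq> nbhd n' t'" using that D(3) by (intro nbhd_mono)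
        then obtain g where g: "g \<in> H k0" "g \<in> P p" "g \<in> nbhd D f" "g \<in> nbhd n' t'"
          using dense_inD[OF dense_P] by blast
        moreover have "g \<in> V" "f \<in> V" using g that t'(1) t by auto
        ultimately show ?thesis using d0[of g f q] that q D(2) unfolding nbhd_def by auto
      qed
      obtain g where g: "g \<in> H k0" "g \<in> P p" "g \<in> V" "\<forall>j<D. g j = f j" "q \<in> \<Phi> g \<longleftrightarrow> q \<in> \<Phi> f"
        using approx[OF f] by blast
      obtain g' where g': "g' \<in> H k0" "g' \<in> P p" "g' \<in> V" "\<forall>j<D. g' j = f' j" "q \<in> \<Phi> g' \<longleftrightarrow> q \<in> \<Phi> f'"
        using approx[OF f'] by blast
      have dg: "dense_in (Q g k \<sigma> m) (cyl \<rho>)" "dense_in (Q g' k \<sigma> m) (cyl \<rho>)"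
        using g(2) g'(2) everywhere_nonmeager_dense unfolding p P_def by auto
      obtain h where h: "h \<in> Q g k \<sigma> m" "h \<in> cyl \<rho>" using dense_inD[OF dg(1) order_refl] by blast
      \<comment> \<open>Both fibres are dense in \<open>cyl \<rho>\<close>, so their parts off
        \<open>J\<close> can be chosen to agree below \<open>D\<close>; on \<open>J\<close>
        agreement comes from \<open>eq\<close>. The mixed points are then close inside one piece
        \<open>H k\<close>.\<close>
      have "nbhd D h \<subseteq> cyl \<rho>" using h D by (intro nbhd_mono)
      then obtain h' where h': "h' \<in> Q g' k \<sigma> m" "h' \<in> nbhd D h" using dense_inD[OF dg(2)] by blast
      have "\<forall>j<D. mix J g h j = mix J g' h' j"
        using h'(2) g(4) g'(4) eq unfolding nbhd_def mix_def by auto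
      then have "q \<in> \<Phi> (mix J g h) \<longleftrightarrow> q \<in> \<Phi> (mix J g' h')"
        using h h' D(1) q by (intro d) (auto simp: Q_def)
      moreover have "q \<in> \<Phi> (mix J g h) \<longleftrightarrow> q \<in> \<Phi> g" "q \<in> \<Phi> (mix J g' h') \<longleftrightarrow> q \<in> \<Phi> g'"
        using h(1) h'(1) q unfolding Q_def by fastforce+
      ultimately show ?thesis using g(5) g'(5) by blast
    qed
    then show "\<exists>d. \<forall>f\<in>H k0 \<inter> nbhd n' t'. \<forall>f'\<in>H k0 \<inter> nbhd n' t'.
       (\<forall>j<d. j \<in> J \<longrightarrow> f j = f' j) \<longrightarrow>
       (\<forall>q<i. m \<le> q \<and> q \<in> \<epsilon> J \<longrightarrow> (q \<in> \<Phi> f \<longleftrightarrow> q \<in> \<Phi> f'))"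
      by (intro exI[of _ D]) blast
  qed
qed

end

text \<open>\<open>U\<close> extends \<open>\<Phi>\<close> from a dense piece, with \<open>d\<close>
  as modulus of continuity. Unlike \<open>\<Phi>\<close> on the piece, it remains continuous at
  points with single coordinates altered, which may leave the piece.\<close>

locale continuous_extension = covered_lifting +
  fixes k0 :: nat and V :: "(nat \<Rightarrow> nat) set" and ns s
    and U :: "(nat \<Rightarrow> nat) \<Rightarrow> nat set" and d :: "nat \<Rightarrow> nat"
  assumes nonmeager_piece: "everywhere_nonmeager (H k0) V"
    and V_def: "V = nbhd ns s"
    and U_eq: "f \<in> H k0 \<Longrightarrow> f \<in> V \<Longrightarrow> U f = \<Phi> f"
    and U_continuous: "(\<And>j. j < d q \<Longrightarrow> f j = f' j) \<Longrightarrow> q \<in> U f \<longleftrightarrow> q \<in> U f'"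
begin

text \<open>Arbitrary points of the cylinder are approximated from the piece. Agreement on all of
  \<open>J\<close> supplies every finite amount of agreement demanded by
  \<open>localize_on_piece\<close>, and continuity of \<open>U\<close> transfers the result.\<close>

lemma localize:
  assumes t: "nbhd nt t \<subseteq> V"
  obtains n' t' m where "nbhd n' t' \<subseteq> nbhd nt t"
    "\<And>f f' q. f \<in> nbhd n' t' \<Longrightarrow> f' \<in> nbhd n' t' \<Longrightarrow> (\<And>j. j \<in> J \<Longrightarrow> f j = f' j) \<Longrightarrow>
       m \<le> q \<Longrightarrow> q \<in> \<epsilon> J \<Longrightarrow> q \<in> U f \<longleftrightarrow> q \<in> U f'"
proof -
  obtain n' t' m where t': "nbhd n' t' \<subseteq> nbhd nt t" and
    cont: "\<And>i. \<exists>d. \<forall>f\<in>H k0 \<inter> nbhd n' t'. \<forall>f'\<in>H k0 \<inter> nbhd n' t'.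
       (\<forall>j<d. j \<in> J \<longrightarrow> f j = f' j) \<longrightarrow>
       (\<forall>q<i. m \<le> q \<and> q \<in> \<epsilon> J \<longrightarrow> (q \<in> \<Phi> f \<longleftrightarrow> q \<in> \<Phi> f'))"
    using localize_on_piece[OF nonmeager_piece t V_def, of J] by blast
  have dn: "dense_in (H k0) V" using nonmeager_piece by (rule everywhere_nonmeager_dense)
  show ?thesis
  proof (rule that[OF t'])
    fix f f' q
    assume f: "f \<in> nbhd n' t'" and f': "f' \<in> nbhd n' t'" and eq: "\<And>j. j \<in> J \<Longrightarrow> f j = f' j"
      and q: "m \<le> q" "q \<in> \<epsilon> J"
    obtain d' where d': "\<And>f f'. f \<in> H k0 \<Longrightarrow> f \<in> nbhd n' t' \<Longrightarrow> f' \<in> H k0 \<Longrightarrow> f' \<in> nbhd n' t' \<Longrightarrow>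
       (\<forall>j<d'. j \<in> J \<longrightarrow> f j = f' j) \<Longrightarrow> q \<in> \<Phi> f \<longleftrightarrow> q \<in> \<Phi> f'"
      using cont[of "Suc q"] q by blast
    define D where "D = max n' (max d' (d q))"
    have approx: "\<exists>g. g \<in> H k0 \<and> g \<in> nbhd n' t' \<and> (\<forall>j<d'. g j = f j) \<and> (q \<in> \<Phi> g \<longleftrightarrow> q \<in> U f)"
      if f: "f \<in> nbhd n' t'" for f
    proof -
      have D: "nbhd D f \<subseteq> nbhd n' t'" using f by (intro nbhd_mono) (auto simp: D_def)
      then obtain g where g: "g \<in> H k0" "g \<in> nbhd D f" using dense_inD[OF dn] t' t by blast
      have "q \<in> U g \<longleftrightarrow> q \<in> U f"
        using g by (intro U_continuous) (auto simp: nbhd_def D_def)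
      moreover have "U g = \<Phi> g" using g D t' t by (intro U_eq) auto
      ultimately show ?thesis using g D by (intro exI[of _ g]) (auto simp: nbhd_def D_def)
    qed
    obtain g g' where "g \<in> H k0" "g \<in> nbhd n' t'" "\<forall>j<d'. g j = f j" "q \<in> \<Phi> g \<longleftrightarrow> q \<in> U f"
      "g' \<in> H k0" "g' \<in> nbhd n' t'" "\<forall>j<d'. g' j = f' j" "q \<in> \<Phi> g' \<longleftrightarrow> q \<in> U f'"
      using approx[OF f] approx[OF f'] by blast
    then show "q \<in> U f \<longleftrightarrow> q \<in> U f'" using d'[of g g'] eq by auto
  qed
qed

definition stable :: "(nat \<Rightarrow> nat) set \<Rightarrow> nat \<Rightarrow> nat \<Rightarrow> bool" where
  "stable T j M \<longleftrightarrow> (\<forall>f\<in>T. \<forall>v. f(j := v) \<in> T \<and> (\<forall>q\<ge>M. q \<in> U (f(j := v)) \<longleftrightarrow> q \<in> U f))"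

text \<open>
  Localizing away from each set of an uncountable almost disjoint family yields the same open set
  and the same error for two of them, \<open>R\<close> and \<open>R'\<close>, sharing a large \<open>j\<close>. A change at \<open>j\<close> is then
  invisible on \<open>\<epsilon> (- R)\<close> and on \<open>\<epsilon> (- R')\<close>, which together miss only finitely many points.
\<close>

lemma unboundedly_many_stable:
  obtains n t where "nbhd n t \<subseteq> V" "\<And>b. \<exists>j\<ge>b. \<exists>M. stable (nbhd n t) j M"
proof -
  have "\<exists>\<sigma> m. cyl \<sigma> \<subseteq> V \<and> (\<forall>f\<in>cyl \<sigma>. \<forall>f'\<in>cyl \<sigma>. (\<forall>j. j \<notin> range (branch z) \<longrightarrow> f j = f' j) \<longrightarrow>
      (\<forall>q\<ge>m. q \<in> \<epsilon> (- range (branch z)) \<longrightarrow> (q \<in> U f \<longleftrightarrow> q \<in> U f')))" for z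
  proof -
    obtain n' t' m where "nbhd n' t' \<subseteq> nbhd ns s"
      "\<And>f f' q. f \<in> nbhd n' t' \<Longrightarrow> f' \<in> nbhd n' t' \<Longrightarrow> (\<And>j. j \<in> - range (branch z) \<Longrightarrow> f j = f' j) \<Longrightarrow>
       m \<le> q \<Longrightarrow> q \<in> \<epsilon> (- range (branch z)) \<Longrightarrow> q \<in> U f \<longleftrightarrow> q \<in> U f'"
      using localize[of ns s "- range (branch z)"] V_def by blast
    then show ?thesis unfolding nbhd_cyl[of n' t'] V_def
      by (intro exI[of _ "map t' [0..<n']"] exI[of _ m]) blast
  qed
  then obtain \<sigma> m where \<sigma>: "\<And>z. cyl (\<sigma> z) \<subseteq> V"
    "\<And>z f f' q. f \<in> cyl (\<sigma> z) \<Longrightarrow> f' \<in> cyl (\<sigma> z) \<Longrightarrow> (\<forall>j. j \<notin> range (branch z) \<longrightarrow> f j = f' j) \<Longrightarrow>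
      q \<ge> m z \<Longrightarrow> q \<in> \<epsilon> (- range (branch z)) \<Longrightarrow> q \<in> U f \<longleftrightarrow> q \<in> U f'"
    by metis
  \<comment> \<open>Cylinder codes and error bounds form a countable set, so uncountably many
    branches share both.\<close>
  obtain p where p: "uncountable {z \<in> UNIV. (\<sigma> z, m z) = p}"
    using uncountable_fibre[OF uncountable_cantor_space] .
  define \<Xi> where "\<Xi> = {z. (\<sigma> z, m z) = p}"
  have \<Xi>: "uncountable \<Xi>" using p by (simp add: \<Xi>_def)
  obtain t m0 where tm: "p = (t, m0)" by (cases p)
  show ?thesis
  proof (rule that)
    obtain z where "z \<in> \<Xi>" using \<Xi> uncountable_infinite by fastforce
    then show "cyl t \<subseteq> V" using \<sigma>(1)[of z] by (simp add: \<Xi>_def tm)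
    fix b
    define N where "N = b + length t"
    obtain y z where yz: "y \<in> \<Xi>" "z \<in> \<Xi>" "y \<noteq> z" "map y [0..<N] = map z [0..<N]"
      using uncountable_not_inj_on[OF \<Xi>, of "\<lambda>z. map z [0..<N]"] .
    \<comment> \<open>The two branches share \<open>N + 1\<close> nodes with distinct codes, so one
      code is at least \<open>N\<close>. It lies beyond \<open>b\<close> and beyond the coordinates
      fixed by the cylinder.\<close>
    have "\<not> branch z ` {..N} \<subseteq> {..<N}"
    proof
      assume "branch z ` {..N} \<subseteq> {..<N}"
      then have "card (branch z ` {..N}) \<le> N" using card_mono[of "{..<N}"] by fastforce
      moreover have "card (branch z ` {..N}) = Suc N"
        using card_image[of "branch z" "{..N}"] inj_branch[of z] by (simp add: inj_on_def inj_def)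
      ultimately show False by simp
    qed
    then obtain n where n: "n \<le> N" "N \<le> branch z n" by force
    define j where "j = branch z n"
    have "branch y n = branch z n" using yz(4) n(1) by (simp add: branch_eq_iff)
    then have j: "j \<in> range (branch y)" "j \<in> range (branch z)" unfolding j_def by (metis rangeI)+
    have jN: "b \<le> j" "length t \<le> j" using n by (auto simp: j_def N_def)
    have "finite (\<epsilon> UNIV - (\<epsilon> (- range (branch y)) \<union> \<epsilon> (- range (branch z))))"
      using finite_branch_Int[OF yz(3)] by (intro support_cofinite) simp
    then obtain M0 where M0: "\<epsilon> UNIV - (\<epsilon> (- range (branch y)) \<union> \<epsilon> (- range (branch z))) \<subseteq> {..<M0}"
      using finite_nat_iff_bounded by blast
    have "stable (cyl t) j (max M0 m0)" if "\<And>f. f \<in> cyl t \<Longrightarrow> U f \<subseteq> \<epsilon> UNIV"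
      unfolding stable_def
    proof (intro ballI allI conjI impI)
      fix f v assume f: "f \<in> cyl t"
      show fv: "f(j := v) \<in> cyl t" using f jN(2) by (auto simp: nbhd_def)
      fix q assume q: "max M0 m0 \<le> q"
      show "q \<in> U (f(j := v)) \<longleftrightarrow> q \<in> U f"
      proof (cases "q \<in> \<epsilon> UNIV")
        case True
        then consider "q \<in> \<epsilon> (- range (branch y))" | "q \<in> \<epsilon> (- range (branch z))" using M0 q by fastforce
        then show ?thesis
        proof cases
          case 1
          then show ?thesis using \<sigma>(2)[of "f(j := v)" y f q] f fv q j yz(1) by (auto simp: \<Xi>_def tm)
        next
          case 2
          then show ?thesis using \<sigma>(2)[of "f(j := v)" z f q] f fv q j yz(2) by (auto simp: \<Xi>_def tm)
        qed
      next
        case False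
        then show ?thesis using that f fv by blast
      qed
    qed
    \<comment> \<open>Whether \<open>q\<close> lies in \<open>U f\<close> is decided by a nearby
      point of the piece, where \<open>U\<close> is \<open>\<Phi>\<close> and takes values inside
      \<open>\<epsilon> UNIV\<close>.\<close>
    moreover have "U f \<subseteq> \<epsilon> UNIV" if f: "f \<in> cyl t" for f
    proof
      fix q assume q: "q \<in> U f"
      have "nbhd (max (length t) (d q)) f \<subseteq> cyl t" using f by (intro nbhd_mono) auto
      then obtain g where g: "g \<in> H k0" "g \<in> V" "g \<in> nbhd (max (length t) (d q)) f"
        using dense_inD[OF everywhere_nonmeager_dense[OF nonmeager_piece]] \<open>cyl t \<subseteq> V\<close> by blast
      have "q \<in> U g" using q U_continuous[of q f g] g(3) by (auto simp: nbhd_def)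
      then show "q \<in> \<epsilon> UNIV" using U_eq[OF g(1,2)] lifting_subset by blast
    qed
    ultimately show "\<exists>j\<ge>b. \<exists>M. stable (cyl t) j M" using jN(1) by blast
  qed
qed

end

context continuous_extension
begin

text \<open>The sequences are built alternately: changes at \<open>j n\<close> affect
  \<open>U\<close> only below \<open>i n\<close>, and \<open>j (Suc n)\<close> exceeds the moduli of
  all points below \<open>i n\<close>. On the segment ending at \<open>i n\<close>, earlier
  coordinates are thus stable and later ones are beyond the modulus, so only \<open>j n\<close>
  matters among the selected ones.\<close>

lemma sparse_coordinates:
  obtains n0 t0 and j i :: "nat \<Rightarrow> nat" where "nbhd n0 t0 \<subseteq> V" "strict_mono j" "strict_mono i"
    "\<And>n f f' q. f \<in> nbhd n0 t0 \<Longrightarrow> f' \<in> nbhd n0 t0 \<Longrightarrow> (\<And>l. l \<notin> range j \<Longrightarrow> f l = f' l) \<Longrightarrow>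
      f (j n) = f' (j n) \<Longrightarrow> q < i n \<Longrightarrow> (\<And>l. l < n \<Longrightarrow> i l \<le> q) \<Longrightarrow> q \<in> U f \<longleftrightarrow> q \<in> U f'"
proof -
  obtain n0 t0 where T: "nbhd n0 t0 \<subseteq> V" and stab: "\<And>b. \<exists>j\<ge>b. \<exists>M. stable (nbhd n0 t0) j M"
    using unboundedly_many_stable by blast
  have stable_mono: "stable (nbhd n0 t0) j M'" if "stable (nbhd n0 t0) j M" "M \<le> M'" for j M M'
    using that unfolding stable_def by auto
  define D where "D i = (\<Sum>q<i. d q)" for i
  have D: "d q \<le> D i" if "q < i" for q i
    unfolding D_def using that member_le_sum[of q "{..<i}" d] by simp
  have step: "\<exists>y. fst x < fst y \<and> snd x < snd y \<and> D (snd x) \<le> fst y \<and>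
      stable (nbhd n0 t0) (fst y) (snd y)" for x :: "nat \<times> nat"
  proof -
    obtain j M where j: "j \<ge> Suc (fst x) + D (snd x)" "stable (nbhd n0 t0) j M"
      using stab by blast
    show ?thesis
      by (rule exI[of _ "(j, max M (Suc (snd x)))"]) (use j stable_mono[OF j(2)] in auto)
  qed
  define p where "p = rec_nat (0, 0) (\<lambda>_ x. SOME y. fst x < fst y \<and> snd x < snd y \<and>
      D (snd x) \<le> fst y \<and> stable (nbhd n0 t0) (fst y) (snd y))"
  have p: "fst (p n) < fst (p (Suc n)) \<and> snd (p n) < snd (p (Suc n)) \<and>
      D (snd (p n)) \<le> fst (p (Suc n)) \<and> stable (nbhd n0 t0) (fst (p (Suc n))) (snd (p (Suc n)))" for n
    using someI_ex[OF step[of "p n"]] by (simp add: p_def)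
  define j where "j n = fst (p (Suc n))" for n
  define i where "i n = snd (p (Suc n))" for n
  have j: "strict_mono j" and i: "strict_mono i"
    using p by (auto simp: j_def i_def strict_mono_Suc_iff)
  have D_le: "D (i n) \<le> j (Suc n)" and st: "stable (nbhd n0 t0) (j n) (i n)" for n
    using p by (auto simp: j_def i_def)
  show ?thesis
  proof (rule that[OF T j i])
    fix n f f' q
    assume f: "f \<in> nbhd n0 t0" and f': "f' \<in> nbhd n0 t0" and eq: "\<And>l. l \<notin> range j \<Longrightarrow> f l = f' l"
      and n: "f (j n) = f' (j n)" and q: "q < i n" "\<And>l. l < n \<Longrightarrow> i l \<le> q"
    \<comment> \<open>Hybrids leading from \<open>f'\<close> towards \<open>f\<close>, one stable
      coordinate at a time; \<open>h n\<close> agrees with \<open>f\<close> below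
      \<open>j (Suc n)\<close>.\<close>
    define h where "h k = mix (j ` {..<k}) f f'" for k
    have hT: "h k \<in> nbhd n0 t0" for k
      using f f' by (auto simp: h_def nbhd_def mix_def)
    have "q \<in> U (h k) \<longleftrightarrow> q \<in> U f'" if "k \<le> n" for k
      using that
    proof (induction k)
      case 0
      have "h 0 = f'" by (auto simp: h_def mix_def)
      then show ?case by simp
    next
      case (Suc k)
      have "h (Suc k) = (h k)(j k := f (j k))"
        by (rule ext) (auto simp: h_def mix_def lessThan_Suc)
      moreover have "q \<in> U ((h k)(j k := f (j k))) \<longleftrightarrow> q \<in> U (h k)"
        using st[of k] hT[of k] q(2)[of k] Suc.prems unfolding stable_def by simp
      ultimately show ?case using Suc.IH Suc.prems by (metis Suc_leD)
    qed
    moreover have "q \<in> U (h n) \<longleftrightarrow> q \<in> U f"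
    proof (rule U_continuous)
      fix l assume "l < d q"
      then have l: "l < j (Suc n)" using D[OF q(1)] D_le[of n] by simp
      show "h n l = f l"
      proof (cases "l \<in> range j")
        case True
        then obtain k where k: "l = j k" by blast
        then have "k < n \<or> k = n" using l j by (auto simp: strict_mono_less)
        then show ?thesis using n by (auto simp: h_def mix_def k)
      next
        case False
        then show ?thesis using eq[of l] by (auto simp: h_def mix_def)
      qed
    qed
    ultimately show "q \<in> U f \<longleftrightarrow> q \<in> U f'" by blast
  qed
qed

text \<open>Two functions of the piece are found that disagree everywhere on an infinite set
  \<open>J\<close> of columns, although their images agree on \<open>\<epsilon> J\<close> up to a
  finite set. By \<open>lifting_disjoint\<close> that common part would be finite, against
  \<open>lifting_infinite\<close>.\<close>

theorem no_continuous_extension: False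
proof -
  obtain n0 t0 and j i :: "nat \<Rightarrow> nat" where T0: "nbhd n0 t0 \<subseteq> V" and j: "strict_mono j" and i: "strict_mono i" and
    seg: "\<And>n f f' q. f \<in> nbhd n0 t0 \<Longrightarrow> f' \<in> nbhd n0 t0 \<Longrightarrow> (\<And>l. l \<notin> range j \<Longrightarrow> f l = f' l) \<Longrightarrow>
      f (j n) = f' (j n) \<Longrightarrow> q < i n \<Longrightarrow> (\<And>l. l < n \<Longrightarrow> i l \<le> q) \<Longrightarrow> q \<in> U f \<longleftrightarrow> q \<in> U f'"
    using sparse_coordinates by blast
  have inj_j: "inj j" using j by (rule strict_mono_imp_inj_on)
  define Z where "Z = range j"
  obtain n1 t1 m1 where T1: "nbhd n1 t1 \<subseteq> nbhd n0 t0" and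
    loc1: "\<And>f f' q. f \<in> nbhd n1 t1 \<Longrightarrow> f' \<in> nbhd n1 t1 \<Longrightarrow> (\<And>j. j \<in> Z \<Longrightarrow> f j = f' j) \<Longrightarrow>
       m1 \<le> q \<Longrightarrow> q \<in> \<epsilon> Z \<Longrightarrow> q \<in> U f \<longleftrightarrow> q \<in> U f'"
    using localize[OF T0, of Z] by blast
  define S where "S n = {q. q < i n \<and> (\<forall>l<n. i l \<le> q)}" for n
  have S: "\<exists>n. q \<in> S n" for q
  proof -
    have "\<exists>n. q < i n"
      using strict_mono_imp_increasing[OF i, of "Suc q"] by (intro exI[of _ "Suc q"]) simp
    then have "q < i (LEAST n. q < i n)" by (rule LeastI_ex)
    moreover have "i l \<le> q" if "l < (LEAST n. q < i n)" for l
      using not_less_Least[OF that] by simp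
    ultimately show ?thesis unfolding S_def by blast
  qed
  \<comment> \<open>The intermediate point takes \<open>Z\<close> from \<open>f\<close> and the rest
    from \<open>f'\<close>: the change off \<open>Z\<close> is invisible by \<open>loc1\<close>, and
    the change on \<open>Z\<close> by \<open>seg\<close>.\<close>
  have coord: "q \<in> U f \<longleftrightarrow> q \<in> U f'"
    if "f \<in> nbhd n1 t1" "f' \<in> nbhd n1 t1" "f (j n) = f' (j n)" "q \<in> S n" "m1 \<le> q" "q \<in> \<epsilon> Z"
    for f f' n q
  proof -
    have m: "mix Z f f' \<in> nbhd n1 t1" using that by (auto simp: nbhd_def mix_def)
    have "q \<in> U f \<longleftrightarrow> q \<in> U (mix Z f f')"
      using that m by (intro loc1) (auto simp: mix_def)
    also have "\<dots> \<longleftrightarrow> q \<in> U f'"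
      using that m T1 by (intro seg[where n=n]) (auto simp: mix_def Z_def S_def)
    finally show ?thesis .
  qed
  have upd: "f(j n := v) \<in> nbhd m f" if "m \<le> j n" for f n v m
    using that by (auto simp: nbhd_def)
  \<comment> \<open>The trace of \<open>U\<close> on one segment as a function of the value at
    \<open>j n\<close>. Infinitely many values share finitely many traces, which yields
    \<open>v n\<close> and \<open>w n\<close>.\<close>
  define a where "a n v = {q \<in> S n \<inter> \<epsilon> Z. m1 \<le> q \<and> q \<in> U (t1(j n := v))}" for n v
  have "\<exists>v w. v \<noteq> w \<and> a n v = a n w" for n
  proof -
    have "range (a n) \<subseteq> Pow {..<i n}" by (auto simp: a_def S_def)
    then have "finite (range (a n))" by (rule finite_subset) simp
    then have "\<not> inj (a n)" using finite_imageD by auto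
    then show ?thesis unfolding inj_def by blast
  qed
  then obtain v w where vw: "\<And>n. v n \<noteq> w n" "\<And>n. a n (v n) = a n (w n)" by metis
  have V1: "nbhd n1 t1 \<subseteq> V" using T1 T0 by blast
  have nm: "\<not> meager (H k0 \<inter> nbhd n1 t1)"
    using nonmeager_piece V1 unfolding everywhere_nonmeager_def by blast
  obtain f where f: "f \<in> H k0 \<inter> nbhd n1 t1" "infinite {n \<in> UNIV. f (j n) = v n}"
    using nonmeager_infinite_hits[OF nm infinite_UNIV_nat inj_j] .
  \<comment> \<open>The hits of \<open>g\<close> are sought among those of \<open>f\<close>, so that
    both occur together infinitely often.\<close>
  obtain g where g: "g \<in> H k0 \<inter> nbhd n1 t1" "infinite {n \<in> {n \<in> UNIV. f (j n) = v n}. g (j n) = w n}"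
    using nonmeager_infinite_hits[OF nm f(2) inj_j] .
  define N where "N = {n. f (j n) = v n \<and> g (j n) = w n}"
  have N: "infinite N" using g(2) by (simp add: N_def)
  define J where "J = j ` N"
  have J: "infinite J" using N inj_j by (simp add: J_def finite_image_iff inj_on_def inj_def)
  \<comment> \<open>This second localization treats segments with \<open>n\<close> outside
    \<open>N\<close>, where nothing relates \<open>f (j n)\<close> to \<open>g (j n)\<close>: then
    \<open>j n\<close> is outside \<open>J\<close>, so its value is invisible on
    \<open>\<epsilon> J\<close>.\<close>
  obtain n2 t2 m2 where T2: "nbhd n2 t2 \<subseteq> nbhd n1 t1" and
    loc2: "\<And>f f' q. f \<in> nbhd n2 t2 \<Longrightarrow> f' \<in> nbhd n2 t2 \<Longrightarrow> (\<And>j. j \<in> J \<Longrightarrow> f j = f' j) \<Longrightarrow>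
       m2 \<le> q \<Longrightarrow> q \<in> \<epsilon> J \<Longrightarrow> q \<in> U f \<longleftrightarrow> q \<in> U f'"
    using localize[OF V1, of J] by blast
  have same: "q \<in> U f \<longleftrightarrow> q \<in> U g"
    if q: "q \<in> \<epsilon> J" "q \<in> \<epsilon> Z" "m1 \<le> q" "m2 \<le> q" "i (n1 + n2) \<le> q" for q
  proof -
    obtain n where n: "q \<in> S n" using S by blast
    have "i (n1 + n2) < i n" using n q(5) by (simp add: S_def)
    then have "n1 + n2 < n" using i by (simp add: strict_mono_less)
    then have jn: "n1 \<le> j n" "n2 \<le> j n" using strict_mono_imp_increasing[OF j, of n] by linarith+
    show ?thesis
    proof (cases "n \<in> N")
      case True
      have t: "t1(j n := x) \<in> nbhd n1 t1" for x using upd[OF jn(1)] .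
      have "q \<in> U f \<longleftrightarrow> q \<in> U (t1(j n := v n))"
        using True f t n q by (intro coord[where n=n]) (auto simp: N_def)
      also have "\<dots> \<longleftrightarrow> q \<in> a n (v n)" using n q by (simp add: a_def)
      also have "\<dots> \<longleftrightarrow> q \<in> a n (w n)" using vw(2) by simp
      also have "\<dots> \<longleftrightarrow> q \<in> U (t1(j n := w n))" using n q by (simp add: a_def)
      also have "\<dots> \<longleftrightarrow> q \<in> U g"
        using True g t n q by (intro coord[where n=n]) (auto simp: N_def)
      finally show ?thesis .
    next
      case False
      then have jJ: "j n \<notin> J" using inj_j by (auto simp: J_def inj_def)
      \<comment> \<open>Updates of \<open>t2\<close> lie in both cylinders, so \<open>coord\<close>
        can move to them and \<open>loc2\<close> can change the value at \<open>j n\<close>.\<close>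
      have t: "t2(j n := x) \<in> nbhd n2 t2" for x using upd[OF jn(2)] .
      then have t': "t2(j n := x) \<in> nbhd n1 t1" for x using T2 by blast
      have "q \<in> U f \<longleftrightarrow> q \<in> U (t2(j n := f (j n)))"
        using f t' n q by (intro coord[where n=n]) auto
      also have "\<dots> \<longleftrightarrow> q \<in> U (t2(j n := g (j n)))"
        using t q jJ by (intro loc2) auto
      also have "\<dots> \<longleftrightarrow> q \<in> U g"
        using g t' n q by (intro coord[where n=n]) auto
      finally show ?thesis .
    qed
  qed
  have Uf: "U f = \<Phi> f" "U g = \<Phi> g" using f g V1 U_eq by blast+
  have fin: "finite (\<Phi> f \<inter> \<Phi> g \<inter> \<epsilon> J)"
  proof (rule lifting_disjoint)
    fix l assume "l \<in> J"
    then obtain n where "l = j n" "f (j n) = v n" "g (j n) = w n" by (auto simp: J_def N_def)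
    then show "f l \<noteq> g l" using vw(1)[of n] by simp
  qed
  have "finite (\<epsilon> J - \<epsilon> Z)" by (intro support_mono) (auto simp: J_def Z_def)
  moreover have "\<Phi> f \<inter> \<epsilon> J \<subseteq> (\<Phi> f \<inter> \<Phi> g \<inter> \<epsilon> J) \<union> (\<epsilon> J - \<epsilon> Z) \<union> {..<m1} \<union> {..<m2} \<union> {..<i (n1 + n2)}"
    using same unfolding Uf by (auto simp flip: not_le)
  ultimately have "finite (\<Phi> f \<inter> \<epsilon> J)"
    using fin by (auto elim: finite_subset)
  then show False using lifting_infinite[OF J] by blast
qed

end

context covered_lifting
begin

text \<open>Some piece of the countable cover is nonmeager by Baire's theorem, hence dense in a
  cylinder; uniform continuity there gives a total extension, which cannot exist.\<close>

theorem inconsistent: False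
proof -
  have "\<not> meager (nbhd 0 (\<lambda>_. 0))" by (rule baire)
  then obtain k0 where "\<not> meager (nbhd 0 (\<lambda>_. 0) \<inter> H k0)"
    using nonmeager_UN_obtain[of "nbhd 0 (\<lambda>_. 0)" H] cover by blast
  then have "\<not> meager (H k0)" using meager_subset by blast
  then obtain s where s: "everywhere_nonmeager (H k0) (cyl s)" by (rule nonmeager_somewhere)
  have "\<exists>d. \<forall>f\<in>H k0 \<inter> cyl s. \<forall>f'\<in>H k0 \<inter> cyl s.
        (\<forall>j<d. f j = f' j) \<longrightarrow> (\<forall>q<i. q \<in> \<Phi> f \<longleftrightarrow> q \<in> \<Phi> f')" for i
    by (intro continuous_on_piece everywhere_nonmeager_dense s)
  then obtain d where "\<And>i. \<forall>f\<in>H k0 \<inter> cyl s. \<forall>f'\<in>H k0 \<inter> cyl s.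
        (\<forall>j<d i. f j = f' j) \<longrightarrow> (\<forall>q<i. q \<in> \<Phi> f \<longleftrightarrow> q \<in> \<Phi> f')"
    by metis
  then have d: "\<And>i f f' q. f \<in> H k0 \<Longrightarrow> f \<in> cyl s \<Longrightarrow> f' \<in> H k0 \<Longrightarrow> f' \<in> cyl s \<Longrightarrow>
        (\<forall>j<d i. f j = f' j) \<Longrightarrow> q < i \<Longrightarrow> q \<in> \<Phi> f \<longleftrightarrow> q \<in> \<Phi> f'"
    by blast
  \<comment> \<open>Membership of \<open>q\<close> is read off from piece members agreeing with
    \<open>f\<close> below \<open>d (Suc q)\<close>; the successor occurs because \<open>d i\<close>
    controls only points strictly below \<open>i\<close>.\<close>
  define U where
    "U f = {q. \<exists>g. g \<in> H k0 \<and> g \<in> cyl s \<and> (\<forall>j<d (Suc q). g j = f j) \<and> q \<in> \<Phi> g}" for f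
  interpret continuous_extension \<Phi> \<epsilon> H k0 "cyl s" "length s" "pad s" U "\<lambda>q. d (Suc q)"
  proof
    show "everywhere_nonmeager (H k0) (cyl s)" by (rule s)
    show "U f = \<Phi> f" if "f \<in> H k0" "f \<in> cyl s" for f
    proof (intro set_eqI iffI)
      fix q assume "q \<in> U f"
      then obtain g where "g \<in> H k0" "g \<in> cyl s" "\<forall>j<d (Suc q). g j = f j" "q \<in> \<Phi> g"
        unfolding U_def by blast
      then show "q \<in> \<Phi> f" using d[of g f "Suc q" q] that by simp
    next
      fix q assume "q \<in> \<Phi> f"
      then show "q \<in> U f" using that unfolding U_def by blast
    qed
    show "q \<in> U f \<longleftrightarrow> q \<in> U f'" if "\<And>j. j < d (Suc q) \<Longrightarrow> f j = f' j" for q f f'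
      using that by (simp add: U_def)
  qed simp
  show False by (rule no_continuous_extension)
qed

end

section \<open>Consequences of the open colouring axiom\<close>

definition first_diff :: "(nat \<Rightarrow> 'a) \<Rightarrow> (nat \<Rightarrow> 'a) \<Rightarrow> real" where
  "first_diff u v = (if u = v then 0 else (1/2) ^ (LEAST n. u n \<noteq> v n))"

lemma first_diff_less_iff: "first_diff u v < (1/2) ^ n \<longleftrightarrow> (\<forall>i\<le>n. u i = v i)"
proof (cases "u = v")
  case False
  define m where "m = (LEAST n. u n \<noteq> v n)"
  have m: "u m \<noteq> v m" unfolding m_def using False LeastI_ex[of "\<lambda>n. u n \<noteq> v n"] by blast
  have below: "u i = v i" if "i < m" for i using not_less_Least[OF that[unfolded m_def]] by simp
  have "first_diff u v = (1/2) ^ m" using False by (simp add: first_diff_def m_def)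
  moreover have "(1/2::real) ^ m < (1/2) ^ n \<longleftrightarrow> n < m" by (simp add: power_strict_decreasing_iff)
  moreover have "n < m \<longleftrightarrow> (\<forall>i\<le>n. u i = v i)"
  proof
    assume "\<forall>i\<le>n. u i = v i"
    then have "\<not> m \<le> n" using m by blast
    then show "n < m" by simp
  qed (use below in auto)
  ultimately show ?thesis by simp
qed (simp add: first_diff_def)

lemma first_diff_nonneg: "0 \<le> first_diff u v"
  by (simp add: first_diff_def)

lemma first_diff_0_iff: "first_diff u v = 0 \<longleftrightarrow> u = v"
  by (simp add: first_diff_def)

lemma first_diff_commute: "first_diff u v = first_diff v u"
proof -
  have "(\<lambda>n. u n \<noteq> v n) = (\<lambda>n. v n \<noteq> u n)" by auto
  then show ?thesis unfolding first_diff_def by auto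
qed

lemma first_diff_ultrametric: "first_diff u w \<le> max (first_diff u v) (first_diff v w)"
proof (cases "u = w")
  case False
  define m where "m = (LEAST n. u n \<noteq> w n)"
  have m: "u m \<noteq> w m" unfolding m_def using False LeastI_ex[of "\<lambda>n. u n \<noteq> w n"] by blast
  have "first_diff u w = (1/2) ^ m" using False by (simp add: first_diff_def m_def)
  moreover have "\<not> (first_diff u v < (1/2) ^ m \<and> first_diff v w < (1/2) ^ m)"
    unfolding first_diff_less_iff using m by auto
  ultimately show ?thesis by auto
next
  case True
  then have "first_diff u w = 0" by (simp add: first_diff_0_iff)
  then show ?thesis by (simp add: first_diff_nonneg le_max_iff_disj)
qed

text \<open>
  Only finitely many coordinates of each of two points are used to see that they are
  \<open>K\<close>-related, which is openness for the topology that \<open>\<iota>\<close> pulls back from the sequence space.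
\<close>

lemma OCA_sequences:
  fixes \<iota> :: "'a \<Rightarrow> nat \<Rightarrow> nat" and K :: "'a \<Rightarrow> 'a \<Rightarrow> bool"
  assumes OCA and inj: "inj \<iota>" and sym: "\<And>p q. K p q \<Longrightarrow> K q p" and irrefl: "\<And>p. \<not> K p p"
    and opn: "\<And>p q. K p q \<Longrightarrow> \<exists>n. \<forall>p' q'. (\<forall>i\<le>n. \<iota> p' i = \<iota> p i \<and> \<iota> q' i = \<iota> q i) \<longrightarrow> K p' q'"
  shows "(\<exists>Y. uncountable Y \<and> pairwise K Y) \<or>
    (\<exists>X :: nat \<Rightarrow> 'a set. (\<Union>n. X n) = UNIV \<and> (\<forall>n. pairwise (\<lambda>p q. \<not> K p q) (X n)))"
proof -
  obtain r :: "nat set \<Rightarrow> real" where r: "inj r"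
    using nat_sets_eqpoll_reals unfolding eqpoll_def bij_betw_def by blast
  \<comment> \<open>A sequence is coded by its graph as a set of naturals and then by a real, since
    \<open>OCA\<close> speaks of sets of reals; the metric is transported from the
    sequences.\<close>
  define j where "j p = r (range (\<lambda>n. prod_encode (n, \<iota> p n)))" for p
  have j: "inj j"
  proof (rule injI)
    fix p q assume "j p = j q"
    then have eq: "range (\<lambda>n. prod_encode (n, \<iota> p n)) = range (\<lambda>n. prod_encode (n, \<iota> q n))"
      using r by (simp add: j_def inj_eq)
    have "\<iota> p n = \<iota> q n" for n
    proof -
      have "prod_encode (n, \<iota> p n) \<in> range (\<lambda>n. prod_encode (n, \<iota> q n))"
        unfolding eq[symmetric] by simp
      then show ?thesis by auto
    qed
    then show "p = q" using injD[OF inj] by blast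
  qed
  define M where "M = range j"
  define d where "d x y = first_diff (\<iota> (inv j x)) (\<iota> (inv j y))" for x y
  have d_j: "d (j p) (j q) = first_diff (\<iota> p) (\<iota> q)" for p q
    using j by (simp add: d_def)
  interpret Metric_space M d
  proof
    show "d x y = 0 \<longleftrightarrow> x = y" if "x \<in> M" "y \<in> M" for x y
      using that inj j by (auto simp: M_def d_j first_diff_0_iff inj_eq)
    show "d x z \<le> d x y + d y z" for x y z
      unfolding d_def using first_diff_ultrametric[of "\<iota> (inv j x)" "\<iota> (inv j z)" "\<iota> (inv j y)"]
        first_diff_nonneg[of "\<iota> (inv j x)" "\<iota> (inv j y)"] first_diff_nonneg[of "\<iota> (inv j y)" "\<iota> (inv j z)"]
      by linarith
  qed (auto simp: d_def first_diff_nonneg first_diff_commute)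
  have "separable_space mtopology"
    unfolding separable_space_def
  proof (intro exI conjI)
    \<comment> \<open>One point is selected for each finite sequence; whenever the sequence is an
      initial segment of some \<open>\<iota> p\<close>, the selected point realizes it.\<close>
    define C where "C = range (\<lambda>(s :: nat list). j (SOME p. map (\<iota> p) [0..<length s] = s))"
    show "countable C" by (simp add: C_def)
    show "C \<subseteq> topspace mtopology" unfolding topspace_mtopology by (auto simp: C_def M_def)
    show "mtopology closure_of C = topspace mtopology"
      unfolding metric_closure_of topspace_mtopology
    proof (intro equalityI subsetI CollectI conjI allI impI)
      fix x and \<epsilon> :: real assume x: "x \<in> M" and "\<epsilon> > 0"
      obtain p where p: "x = j p" using x by (auto simp: M_def)
      obtain n where n: "(1/2) ^ n < \<epsilon>" using real_arch_pow_inv[OF \<open>\<epsilon> > 0\<close>, of "1/2"] by auto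
      define s where "s = map (\<iota> p) [0..<Suc n]"
      define q where "q = (SOME q. map (\<iota> q) [0..<length s] = s)"
      have "map (\<iota> q) [0..<length s] = s"
        unfolding q_def by (rule someI[of _ p]) (simp add: s_def)
      then have "\<forall>i\<le>n. \<iota> q i = \<iota> p i"
        unfolding s_def by (simp add: list_eq_iff_nth_eq less_Suc_eq_le del: upt_Suc)
      then have "d x (j q) < (1/2) ^ n" unfolding p d_j first_diff_less_iff by auto
      moreover have "j q \<in> C" unfolding C_def q_def by blast
      ultimately show "\<exists>y\<in>C. y \<in> mball x \<epsilon>" using x n by (intro bexI[of _ "j q"]) (unfold in_mball, auto simp: M_def)
    qed auto
  qed
  define K0 where "K0 = {{j p, j q} | p q. K p q}"
  define K1 where "K1 = nsets M 2 - K0"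
  have K0_iff: "{j p, j q} \<in> K0 \<longleftrightarrow> K p q" for p q
    using j sym by (auto simp: K0_def doubleton_eq_iff inj_eq)
  have K0_sub: "K0 \<subseteq> nsets M 2"
  proof
    fix A assume "A \<in> K0"
    then obtain p q where A: "A = {j p, j q}" "K p q" by (auto simp: K0_def)
    then have "j p \<noteq> j q" using irrefl j by (auto simp: inj_eq)
    then show "A \<in> nsets M 2" using A by (auto simp: nsets_def M_def)
  qed
  have open_K0: "openin (prod_topology mtopology mtopology) {(x, y). {x, y} \<in> K0}"
    unfolding openin_prod_topology_alt
  proof (intro allI impI)
    fix x y assume "(x, y) \<in> {(x, y). {x, y} \<in> K0}"
    then have xy: "{x, y} \<in> K0" by simp
    then have "x \<in> M" "y \<in> M" using K0_sub by (auto simp: nsets_def)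
    then obtain p q where p: "x = j p" and q: "y = j q" by (auto simp: M_def)
    then have "K p q" using xy K0_iff by blast
    then obtain n where n: "\<And>p' q'. (\<forall>i\<le>n. \<iota> p' i = \<iota> p i \<and> \<iota> q' i = \<iota> q i) \<Longrightarrow> K p' q'"
      using opn by blast
    have "mball x ((1/2) ^ n) \<times> mball y ((1/2) ^ n) \<subseteq> {(x, y). {x, y} \<in> K0}"
    proof clarify
      fix x' y' assume "x' \<in> mball x ((1/2) ^ n)" "y' \<in> mball y ((1/2) ^ n)"
      then obtain p' q' where "x' = j p'" "y' = j q'" "first_diff (\<iota> p) (\<iota> p') < (1/2) ^ n"
         "first_diff (\<iota> q) (\<iota> q') < (1/2) ^ n"
        unfolding in_mball unfolding p q M_def using d_j by auto
      then show "{x', y'} \<in> K0" unfolding first_diff_less_iff K0_iff by (auto intro!: n simp: K0_iff)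
    qed
    then show "\<exists>U V. openin mtopology U \<and> openin mtopology V \<and> x \<in> U \<and> y \<in> V \<and>
        U \<times> V \<subseteq> {(x, y). {x, y} \<in> K0}"
      using \<open>x \<in> M\<close> \<open>y \<in> M\<close>
      by (intro exI[of _ "mball x ((1/2) ^ n)"] exI[of _ "mball y ((1/2) ^ n)"]) auto
  qed
  have doubleton: "{j p, j q} \<in> nsets (j ` Z) 2" if "p \<in> Z" "q \<in> Z" "p \<noteq> q" for p q Z
    using that j by (auto simp: nsets_def inj_eq)
  have "(\<exists>Y\<subseteq>M. uncountable Y \<and> nsets Y 2 \<subseteq> K0) \<or>
        (\<exists>X :: nat \<Rightarrow> real set. M = (\<Union>n. X n) \<and> (\<forall>n. nsets (X n) 2 \<subseteq> K1))"
  proof (rule \<open>OCA\<close>[unfolded OCA_def, THEN spec[of _ M], THEN spec[of _ d], THEN spec[of _ K0],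
        THEN spec[of _ K1], THEN mp], intro conjI)
    show "K0 \<union> K1 = nsets M 2" "K0 \<inter> K1 = {}" using K0_sub by (auto simp: K1_def)
  qed (fact Metric_space_axioms \<open>separable_space mtopology\<close> open_K0)+
  then show ?thesis
  proof (elim disjE exE conjE)
    fix Y assume Y: "Y \<subseteq> M" "uncountable Y" "nsets Y 2 \<subseteq> K0"
    define Z where "Z = j -` Y"
    have YZ: "Y = j ` Z" using Y(1) by (auto simp: Z_def M_def)
    then have "uncountable Z" using Y(2) by auto
    moreover have "pairwise K Z"
    proof (rule pairwiseI)
      fix p q assume "p \<in> Z" "q \<in> Z" "p \<noteq> q"
      then have "{j p, j q} \<in> K0" using doubleton[of p Z q] Y(3) YZ by blast
      then show "K p q" by (simp only: K0_iff)
    qed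
    ultimately show ?thesis by blast
  next
    fix X :: "nat \<Rightarrow> real set" assume X: "M = (\<Union>n. X n)" "\<forall>n. nsets (X n) 2 \<subseteq> K1"
    define Z where "Z n = j -` X n" for n
    have "X n \<subseteq> range j" for n using X(1) M_def by (metis UN_upper UNIV_I)
    then have XZ: "X n = j ` Z n" for n unfolding Z_def image_vimage_eq by blast
    have "j p \<in> (\<Union>n. X n)" for p unfolding X(1)[symmetric] M_def by simp
    then have "(\<Union>n. Z n) = UNIV" by (auto simp: Z_def)
    moreover have "pairwise (\<lambda>p q. \<not> K p q) (Z n)" for n
    proof (rule pairwiseI)
      fix p q assume "p \<in> Z n" "q \<in> Z n" "p \<noteq> q"
      then have "{j p, j q} \<in> K1" using doubleton[of p "Z n" q] spec[OF X(2), of n] unfolding XZ[of n] by (meson subsetD)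
      then have "{j p, j q} \<notin> K0" by (simp add: K1_def)
      then show "\<not> K p q" by (simp only: K0_iff not_False_eq_True)
    qed
    ultimately show ?thesis by blast
  qed
qed

text \<open>\<open>G\<close> chooses representatives for an embedding of the subsets of the plane,
  modulo sets meeting finitely many columns, into the subsets of the naturals modulo finite sets.
  The lattice identities hence hold up to finite errors.\<close>

locale lifted_embedding =
  fixes G :: "(nat \<times> nat) set \<Rightarrow> nat set"
  assumes Un: "finite (sym_diff (G (X \<union> Y)) (G X \<union> G Y))"
    and Int: "finite (sym_diff (G (X \<inter> Y)) (G X \<inter> G Y))"
    and finite_iff: "finite (G X) \<longleftrightarrow> finite (fst ` X)"
begin

definition strip :: "(nat \<Rightarrow> bool) \<Rightarrow> nat set \<Rightarrow> (nat \<times> nat) set" where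
  "strip x J = branch x ` J \<times> UNIV"

definition graph :: "(nat \<Rightarrow> bool) \<Rightarrow> (nat \<Rightarrow> nat) \<Rightarrow> (nat \<times> nat) set" where
  "graph x f = range (\<lambda>n. (branch x n, f n))"

abbreviation e :: "(nat \<Rightarrow> bool) \<Rightarrow> nat set" where
  "e x \<equiv> G (strip x UNIV)"

text \<open>Cutting down to \<open>e x\<close> alters the image only finitely and makes the
  inclusion in \<open>e x\<close> exact. Exactness allows \<open>g x f\<close> to be compared
  pointwise with sets on another branch.\<close>

definition g :: "(nat \<Rightarrow> bool) \<Rightarrow> (nat \<Rightarrow> nat) \<Rightarrow> nat set" where
  "g x f = G (graph x f) \<inter> e x"

text \<open>
  The second conjunct is an open condition because distinct branches share only finitely many
  columns; it allows a homogeneous set of partial functions to be glued together.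
\<close>

fun K :: "(nat \<Rightarrow> bool) \<times> (nat \<Rightarrow> nat) \<Rightarrow> (nat \<Rightarrow> bool) \<times> (nat \<Rightarrow> nat) \<Rightarrow> bool" where
  "K (x, f) (y, h) \<longleftrightarrow> x \<noteq> y \<and> (\<forall>n. (\<forall>i<n. x i = y i) \<longrightarrow> f n = h n) \<and> g x f \<inter> e y \<noteq> g y h \<inter> e x"

text \<open>Recording the traces of \<open>e x\<close> and \<open>g x f\<close> refines the topology
  so that a difference between the two intersections in \<open>K\<close>, witnessed by one number,
  is an open condition.\<close>

fun code :: "(nat \<Rightarrow> bool) \<times> (nat \<Rightarrow> nat) \<Rightarrow> nat \<Rightarrow> nat" where
  "code (x, f) n = to_nat (x n, f n, n \<in> e x, n \<in> g x f)"

lemma mono: "X \<subseteq> Y \<Longrightarrow> finite (G X - G Y)"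
proof -
  assume "X \<subseteq> Y"
  then have "X \<inter> Y = X" by auto
  then have "finite (sym_diff (G X) (G X \<inter> G Y))" using Int[of X Y] by simp
  then show ?thesis by (rule rev_finite_subset) auto
qed

lemma graph_strip: "graph x f \<inter> strip x J = (\<lambda>n. (branch x n, f n)) ` J"
  using inj_branch[of x] by (auto simp: graph_def strip_def inj_def)

lemma graph_subset_strip: "graph x f \<subseteq> strip x UNIV"
  by (auto simp: graph_def strip_def)

lemma g_almost: "finite (sym_diff (g x f) (G (graph x f)))"
  using mono[OF graph_subset_strip[of x f]] by (rule rev_finite_subset) (auto simp: g_def)

lemma K_sym: "K p q \<Longrightarrow> K q p"
  by (cases p; cases q) auto

lemma K_irrefl: "\<not> K p p"
  by (cases p) auto

text \<open>A place \<open>a\<close> where the branches differ bounds the levels relevant to the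
  second conjunct, and a single \<open>b\<close> witnesses the third.\<close>

lemma K_open:
  assumes "K p q"
  shows "\<exists>n. \<forall>p' q'. (\<forall>i\<le>n. code p' i = code p i \<and> code q' i = code q i) \<longrightarrow> K p' q'"
proof -
  obtain x f y h where p: "p = (x, f)" and q: "q = (y, h)" by (cases p; cases q)
  obtain a where a: "x a \<noteq> y a" using assms by (auto simp: p q)
  have agree: "f n = h n" if "\<forall>i<n. x i = y i" for n using assms that by (simp add: p q)
  have "g x f \<inter> e y \<noteq> g y h \<inter> e x" using assms by (simp add: p q)
  then obtain b where b: "\<not> (b \<in> g x f \<inter> e y \<longleftrightarrow> b \<in> g y h \<inter> e x)" by blast
  have "K p' q'" if c: "\<forall>i\<le>max a b. code p' i = code p i \<and> code q' i = code q i" for p' q'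
  proof -
    obtain x' f' y' h' where p': "p' = (x', f')" and q': "q' = (y', h')" by (cases p'; cases q')
    have eq: "x' i = x i" "f' i = f i" "i \<in> e x' \<longleftrightarrow> i \<in> e x" "i \<in> g x' f' \<longleftrightarrow> i \<in> g x f"
        "y' i = y i" "h' i = h i" "i \<in> e y' \<longleftrightarrow> i \<in> e y" "i \<in> g y' h' \<longleftrightarrow> i \<in> g y h"
      if "i \<le> max a b" for i
      using c[rule_format, OF that] by (simp_all add: p p' q q')
    have "x' \<noteq> y'" using a eq(1)[of a] eq(5)[of a] by auto
    moreover have "f' n = h' n" if n: "\<forall>i<n. x' i = y' i" for n
    proof -
      have "n \<le> a" using n a eq(1)[of a] eq(5)[of a] by (metis max.cobounded1 not_le)
      then have "\<forall>i<n. x i = y i" using n eq(1) eq(5) by (metis le_max_iff_disj less_imp_le less_le_trans)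
      then show ?thesis using agree eq(2)[of n] eq(6)[of n] \<open>n \<le> a\<close> by auto
    qed
    moreover have "g x' f' \<inter> e y' \<noteq> g y' h' \<inter> e x'"
      using b eq(3)[of b] eq(4)[of b] eq(7)[of b] eq(8)[of b] by auto
    ultimately show ?thesis by (simp add: p' q')
  qed
  then show ?thesis by blast
qed

text \<open>Compatibility glues all graphs into one set \<open>F\<close> whose trace on each strip
  is the corresponding graph. So each \<open>g x f\<close> is almost
  \<open>G F \<inter> e x\<close>; for two points with the same error bound and the same data below
  it, the intersections compared by \<open>K\<close> coincide.\<close>

lemma no_uncountable_homogeneous:
  assumes "pairwise K Y"
  shows "countable Y"
proof (rule ccontr)
  assume Y: "uncountable Y"
  define F where "F = (\<Union>(x, f)\<in>Y. graph x f)"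
  have F: "F \<inter> strip x UNIV = graph x f" if xf: "(x, f) \<in> Y" for x f
  proof
    show "graph x f \<subseteq> F \<inter> strip x UNIV" using xf graph_subset_strip by (auto simp: F_def)
    show "F \<inter> strip x UNIV \<subseteq> graph x f"
    proof
      fix p assume "p \<in> F \<inter> strip x UNIV"
      then obtain y h n m where yh: "(y, h) \<in> Y" "p = (branch y n, h n)" "branch y n = branch x m"
        unfolding F_def graph_def strip_def by blast
      have nm: "n = m" "\<forall>i<n. x i = y i" using yh(3) by (auto simp: branch_eq_iff)
      have "f n = h n"
      proof (cases "(y, h) = (x, f)")
        case False
        then have "K (x, f) (y, h)" using assms xf yh(1) unfolding pairwise_def by metis
        then show ?thesis using nm by simp
      qed simp
      then show "p \<in> graph x f" using yh nm by (auto simp: graph_def)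
    qed
  qed
  have "\<exists>m. \<forall>q\<ge>m. q \<in> g (fst p) (snd p) \<longleftrightarrow> q \<in> G F \<inter> e (fst p)" if "p \<in> Y" for p
  proof -
    obtain x f where p: "p = (x, f)" by (cases p)
    have "finite (sym_diff (G (graph x f)) (G F \<inter> e x))"
      using Int[of F "strip x UNIV"] F that by (simp add: p)
    then have "finite (sym_diff (g x f) (G (graph x f)) \<union> sym_diff (G (graph x f)) (G F \<inter> e x))"
      using g_almost by simp
    then have "finite (sym_diff (g x f) (G F \<inter> e x))" by (rule rev_finite_subset) auto
    then obtain m where "sym_diff (g x f) (G F \<inter> e x) \<subseteq> {..<m}"
      using finite_nat_iff_bounded by blast
    then show ?thesis by (intro exI[of _ m]) (auto simp: p)
  qed
  then have "\<forall>p\<in>Y. \<exists>m. \<forall>q\<ge>m. q \<in> g (fst p) (snd p) \<longleftrightarrow> q \<in> G F \<inter> e (fst p)" by blast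
  from bchoice[OF this] obtain m
    where m: "\<forall>p\<in>Y. \<forall>q\<ge>m p. q \<in> g (fst p) (snd p) \<longleftrightarrow> q \<in> G F \<inter> e (fst p)" ..
  \<comment> \<open>The error bound and the finite traces below it take countably many values, so
    two points of \<open>Y\<close> share them.\<close>
  define c where "c = (\<lambda>(x, f). (m (x, f), map (\<lambda>q. (q \<in> g x f, q \<in> e x)) [0..<m (x, f)]))"
  obtain p q where pq: "p \<in> Y" "q \<in> Y" "p \<noteq> q" "c p = c q"
    using uncountable_not_inj_on[OF Y, of c] .
  obtain x f y h where p: "p = (x, f)" and q: "q = (y, h)" by (cases p; cases q)
  have mm: "m (x, f) = m (y, h)" using pq(4) by (simp add: c_def p q)
  have below: "b \<in> g x f \<longleftrightarrow> b \<in> g y h" "b \<in> e x \<longleftrightarrow> b \<in> e y" if "b < m (x, f)" for b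
    using pq(4) mm that by (auto simp: c_def p q)
  have "b \<in> g x f \<inter> e y \<longleftrightarrow> b \<in> g y h \<inter> e x" for b
  proof (cases "b < m (x, f)")
    case True
    then show ?thesis using below by (auto simp: g_def)
  next
    case False
    then show ?thesis using m[rule_format, OF pq(1), of b] m[rule_format, OF pq(2), of b] mm by (auto simp: p q)
  qed
  then have "g x f \<inter> e y = g y h \<inter> e x" by blast
  moreover have "K p q" using assms pq unfolding pairwise_def by blast
  ultimately show False by (simp add: p q)
qed

lemma inj_code: "inj code"
proof (rule injI)
  fix p q assume "code p = code q"
  then have eq: "code p n = code q n" for n by simp
  obtain x f y h where p: "p = (x, f)" and q: "q = (y, h)" by (cases p; cases q)
  have "x n = y n" "f n = h n" for n using eq[of n] by (simp_all add: p q)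
  then show "p = q" by (auto simp: p q)
qed

text \<open>\<open>OCA\<close> leaves a countable cover by sets without \<open>K\<close>-related
  pairs. Fix a branch \<open>x\<close> that is a limit of other branches \<open>y\<close> wherever a
  section is dense. A function \<open>h\<close> paired with a nearby \<open>y\<close> then
  determines \<open>g x f \<inter> e y\<close> for all \<open>f\<close> close to \<open>h\<close>,
  which gives the continuity on pieces required by \<open>covered_lifting\<close>.\<close>

theorem not_OCA: "\<not> OCA"
proof
  assume OCA
  then obtain H :: "nat \<Rightarrow> ((nat \<Rightarrow> bool) \<times> (nat \<Rightarrow> nat)) set"
    where H: "(\<Union>k. H k) = UNIV" "\<And>k. pairwise (\<lambda>p q. \<not> K p q) (H k)"
    using OCA_sequences[of code K, OF _ inj_code K_sym K_irrefl K_open] no_uncountable_homogeneous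
    by blast
  define S where "S k x = {f. (x, f) \<in> H k}" for k x
  define X where "X = (\<lambda>(k, s). {x. dense_in (S k x) (cyl s)})"
  \<comment> \<open>Closeness compares finitely many bits of a branch and of its \<open>e\<close>
    set. These finite data are countable in number, so each \<open>X ks\<close> has only countably
    many isolated points.\<close>
  define close where "close i x y \<longleftrightarrow> (\<forall>q<i. x q = y q \<and> (q \<in> e x \<longleftrightarrow> q \<in> e y))" for i :: nat and x y
  define isolated where "isolated ks = {x \<in> X ks. \<exists>i. \<forall>y\<in>X ks. y \<noteq> x \<longrightarrow> \<not> close i x y}" for ks
  have "countable (isolated ks)" for ks
  proof (rule ccontr)
    assume unc: "uncountable (isolated ks)"
    obtain i where i: "\<And>x y. x \<in> isolated ks \<Longrightarrow> y \<in> X ks \<Longrightarrow> y \<noteq> x \<Longrightarrow> \<not> close (i x) x y"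
    proof -
      have "\<forall>x\<in>isolated ks. \<exists>i. \<forall>y\<in>X ks. y \<noteq> x \<longrightarrow> \<not> close i x y"
        by (simp add: isolated_def)
      then show ?thesis using that bchoice by metis
    qed
    obtain x y where xy: "x \<in> isolated ks" "y \<in> isolated ks" "x \<noteq> y"
      "(i x, map (\<lambda>q. (x q, q \<in> e x)) [0..<i x]) = (i y, map (\<lambda>q. (y q, q \<in> e y)) [0..<i y])"
      using uncountable_not_inj_on[OF unc, of "\<lambda>x. (i x, map (\<lambda>q. (x q, q \<in> e x)) [0..<i x])"] .
    have "close (i x) x y" using xy(4) by (auto simp: close_def)
    then show False using i[OF xy(1), of y] xy(2,3) by (auto simp: isolated_def)
  qed
  then have "countable (\<Union>ks :: nat \<times> nat list. isolated ks)" by simp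
  then obtain x where x: "x \<notin> (\<Union>ks. isolated ks)"
    using uncountable_cantor_space by (metis UNIV_eq_I)
  have limit: "\<exists>y\<in>X ks. y \<noteq> x \<and> close i x y" if "x \<in> X ks" for ks i
    using x that unfolding isolated_def by blast
  have graph_J: "finite (sym_diff (G (graph x f \<inter> strip x J)) (G (graph x f) \<inter> G (strip x J)))" for f J
    by (rule Int)
  interpret covered_lifting "g x" "\<lambda>J. G (strip x J)" "\<lambda>k. S k x"
  proof
    show "(\<Union>k. S k x) = UNIV" using H(1) by (auto simp: S_def)
    show "g x f \<subseteq> G (strip x UNIV)" for f by (auto simp: g_def)
    show "finite (G (strip x J) - G (strip x J'))" if "J \<subseteq> J'" for J J'
      using that by (intro mono) (auto simp: strip_def)
    show "finite (G (strip x UNIV) - (G (strip x J) \<union> G (strip x J')))" if fin: "finite (- (J \<union> J'))" for J J'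
    proof -
      define R where "R = strip x (- (J \<union> J'))"
      have R: "strip x UNIV = strip x J \<union> strip x J' \<union> R" by (auto simp: strip_def R_def)
      have "finite (fst ` R)" using fin by (auto simp: R_def strip_def intro: finite_subset)
      then have "finite (G R)" by (simp add: finite_iff)
      then have "finite (sym_diff (e x) (G (strip x J \<union> strip x J') \<union> G R) \<union> G R \<union>
          sym_diff (G (strip x J \<union> strip x J')) (G (strip x J) \<union> G (strip x J')))"
        using Un[of "strip x J \<union> strip x J'" R] Un[of "strip x J" "strip x J'"] R by simp
      then show ?thesis by (rule rev_finite_subset) auto
    qed
    show "finite (sym_diff (g x f) (g x f') \<inter> G (strip x J))" if "\<And>j. j \<in> J \<Longrightarrow> f j = f' j" for J f f'
    proof -
      have "graph x f \<inter> strip x J = graph x f' \<inter> strip x J"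
        unfolding graph_strip using that by auto
      then show ?thesis
        by (intro finite_subset[OF _ finite_UnI[OF graph_J[of f J] graph_J[of f' J]]]) (auto simp: g_def)
    qed
    show "finite (g x f \<inter> g x f' \<inter> G (strip x J))" if "\<And>j. j \<in> J \<Longrightarrow> f j \<noteq> f' j" for J f f'
    proof -
      have "(graph x f \<inter> strip x J) \<inter> (graph x f' \<inter> strip x J) = {}"
        unfolding graph_strip using that inj_branch[of x] by (auto simp: inj_def)
      then have "finite (G (graph x f \<inter> strip x J) \<inter> G (graph x f' \<inter> strip x J))"
        using Int[of "graph x f \<inter> strip x J" "graph x f' \<inter> strip x J"] finite_iff[of "{}"]
        by (simp add: Un_commute)
      then have "finite (G (graph x f \<inter> strip x J) \<inter> G (graph x f' \<inter> strip x J) \<union>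
          sym_diff (G (graph x f \<inter> strip x J)) (G (graph x f) \<inter> G (strip x J)) \<union>
          sym_diff (G (graph x f' \<inter> strip x J)) (G (graph x f') \<inter> G (strip x J)))"
        using graph_J[of f J] graph_J[of f' J] by simp
      then show ?thesis by (rule rev_finite_subset) (auto simp: g_def)
    qed
    show "infinite (g x f \<inter> G (strip x J))" if "infinite J" for J f
    proof
      assume "finite (g x f \<inter> G (strip x J))"
      then have "finite (g x f \<inter> G (strip x J) \<union> sym_diff (g x f) (G (graph x f)) \<union>
          sym_diff (G (graph x f \<inter> strip x J)) (G (graph x f) \<inter> G (strip x J)))"
        using g_almost graph_J by simp
      then have "finite (G (graph x f \<inter> strip x J))" by (rule rev_finite_subset) auto
      then have "finite (branch x ` J)" by (simp add: finite_iff graph_strip image_image)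
      then show False using that inj_branch[of x] by (simp add: finite_image_iff inj_on_def inj_def)
    qed
    fix k n c i
    assume dense: "dense_in (S k x) (nbhd n c)"
    define s where "s = map c [0..<n]"
    have s: "nbhd n c = cyl s" unfolding s_def by (rule nbhd_cyl)
    have "x \<in> X (k, s)" using dense by (simp add: X_def s)
    \<comment> \<open>Closeness up to \<open>i\<close> makes \<open>e x\<close> and
      \<open>e y\<close> agree on the points concerned; closeness up to \<open>n\<close> puts the
      splitting position beyond the coordinates fixed by \<open>nbhd n c\<close>.\<close>
    then obtain y where y: "y \<in> X (k, s)" "y \<noteq> x" "close (max i n) x y" using limit by blast
    obtain a where a: "x a \<noteq> y a" using y(2) by blast
    define d where "d = Suc a"
    have na: "n \<le> a" using y(3) a unfolding close_def by (metis max.strict_coboundedI2 not_le)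
    have dense_y: "dense_in (S k y) (nbhd n c)" using y(1) unfolding s X_def by simp
    have "q \<in> g x f \<longleftrightarrow> q \<in> g x f'"
      if f: "f \<in> S k x \<inter> nbhd n c" and f': "f' \<in> S k x \<inter> nbhd n c"
        and eq: "\<forall>j<d. f j = f' j" and q: "q < i" for f f' q
    proof -
      have "nbhd d f \<subseteq> nbhd n c" using f na by (intro nbhd_mono) (auto simp: d_def)
      then obtain h where h: "h \<in> S k y" "h \<in> nbhd d f"
        using dense_inD[OF dense_y] by blast
      \<comment> \<open>The first two conjuncts of \<open>K\<close> hold, since the branches differ
        and \<open>f\<close>, \<open>h\<close> agree below \<open>Suc a\<close>, which covers all
        common levels. As the pair is not \<open>K\<close>-related, the third conjunct must
        fail.\<close>
      have *: "g x f \<inter> e y = g y h \<inter> e x" if "f \<in> S k x" "\<forall>j<d. f j = h j" for f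
      proof -
        have "\<not> K (x, f) (y, h)"
        proof (rule pairwiseD[OF H(2)[of k]])
          show "(x, f) \<in> H k" "(y, h) \<in> H k" using that(1) h(1) by (simp_all add: S_def)
          show "(x, f) \<noteq> (y, h)" using y(2) by simp
        qed
        moreover have "f l = h l" if "\<forall>i<l. x i = y i" for l
        proof -
          have "l \<le> a" using that a by (metis not_le)
          then show ?thesis using \<open>\<forall>j<d. f j = h j\<close> by (simp add: d_def)
        qed
        moreover have "x \<noteq> y" using y(2) by simp
        ultimately show ?thesis unfolding K.simps by blast
      qed
      have "g x f \<inter> e y = g x f' \<inter> e y"
        using *[of f] *[of f'] f f' h(2) eq by (auto simp: nbhd_def)
      moreover have "q \<in> e x \<longleftrightarrow> q \<in> e y" using y(3) q unfolding close_def by auto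
      ultimately show ?thesis unfolding g_def by blast
    qed
    then show "\<exists>d. \<forall>f\<in>S k x \<inter> nbhd n c. \<forall>f'\<in>S k x \<inter> nbhd n c.
        (\<forall>j<d. f j = f' j) \<longrightarrow> (\<forall>q<i. q \<in> g x f \<longleftrightarrow> q \<in> g x f')"
      by (intro exI[of _ d]) blast
  qed
  show False by (rule inconsistent)
qed

end

section \<open>The two halves of the theorem\<close>

lemma CH_imp_iso:
  assumes CH
  shows "\<exists>f :: B1 \<Rightarrow> B2. boolean_algebra_iso f"
proof -
  obtain lt :: "nat set rel" where lt: "wf lt" "\<And>i j. i = j \<or> (i, j) \<in> lt \<or> (j, i) \<in> lt"
    "\<And>i. countable {j. (j, i) \<in> lt}"
    by (rule CH_wellorder[OF assms]) (rule that)
  have "(top :: B1) \<noteq> bot"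
    using abs_B1_eq_bot_iff[of UNIV] by (simp add: top_B1.abs_eq)
  moreover have "(top :: B2) \<noteq> bot"
  proof -
    have "infinite (fst ` (UNIV :: (nat \<times> nat) set))" by simp
    then have "range spine \<notin> no_inf_antichain" using spine_image_in_ideal_iff by blast
    then have "UNIV \<notin> no_inf_antichain"
      using set_ideal_subset[OF set_ideal_no_inf_antichain _ subset_UNIV] by blast
    then show ?thesis using abs_B2_eq_bot_iff[of UNIV] by (simp add: top_B2.abs_eq)
  qed
  moreover have "surj abs_B1" by (rule surjI[of _ rep_B1]) (rule abs_B1_rep)
  \<comment> \<open>Words are countable, so sets of naturals also enumerate \<open>B2\<close>; both
    algebras share one index type for the back-and-forth construction.\<close>
  moreover have "surj (\<lambda>A. abs_B2 (from_nat ` A))"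
  proof (rule surjI)
    fix x
    have "from_nat ` to_nat ` rep_B2 x = rep_B2 x" by (simp add: image_image)
    then show "abs_B2 (from_nat ` to_nat ` rep_B2 x) = x" by (simp add: abs_B2_rep)
  qed
  ultimately obtain f :: "B1 \<Rightarrow> B2" where "boolean_algebra_iso f"
    by (rule back_and_forth[OF saturated_B1 saturated_B2 _ _ lt])
  then show ?thesis by blast
qed

text \<open>The inverse isomorphism composed with \<open>spine\<close> embeds the column quotient
  into \<open>B1\<close>; choosing representatives gives a \<open>lifted_embedding\<close>.\<close>

lemma iso_imp_not_OCA:
  assumes f: "boolean_algebra_iso (f :: B1 \<Rightarrow> B2)"
  shows "\<not> OCA"
proof -
  define h where "h = inv f"
  have bij: "bij f" and f_inf: "\<And>x y. f (inf x y) = inf (f x) (f y)"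
    and f_sup: "\<And>x y. f (sup x y) = sup (f x) (f y)" and f_bot: "f bot = bot"
    using f by (auto simp: boolean_algebra_iso_def)
  have fh: "f (h x) = x" for x unfolding h_def using bij by (simp add: bij_is_surj surj_f_inv_f)
  have inj: "f x = f y \<longleftrightarrow> x = y" for x y using bij by (simp add: bij_is_inj inj_eq)
  have h_inf: "h (inf x y) = inf (h x) (h y)" for x y
    by (simp add: fh f_inf flip: inj)
  have h_sup: "h (sup x y) = sup (h x) (h y)" for x y
    by (simp add: fh f_sup flip: inj)
  have h_bot: "h x = bot \<longleftrightarrow> x = bot" for x
    using inj[of "h x" bot] by (simp add: fh f_bot)
  define G where "G X = rep_B1 (h (abs_B2 (spine ` X)))" for X
  have G: "abs_B1 (G X) = h (abs_B2 (spine ` X))" for X by (simp add: G_def abs_B1_rep)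
  have almost_eq: "finite (sym_diff A B)" if "abs_B1 A = abs_B1 B" for A B
    using that by (simp add: B1.abs_eq_iff eq_mod_def Fin_def)
  interpret lifted_embedding G
  proof
    fix X Y
    show "finite (sym_diff (G (X \<union> Y)) (G X \<union> G Y))"
      by (rule almost_eq) (simp add: G image_Un h_sup flip: sup_B1.abs_eq sup_B2.abs_eq)
    show "finite (sym_diff (G (X \<inter> Y)) (G X \<inter> G Y))"
      by (rule almost_eq) (simp add: G image_Int[OF inj_spine] h_inf flip: inf_B1.abs_eq inf_B2.abs_eq)
    show "finite (G X) \<longleftrightarrow> finite (fst ` X)"
      using abs_B1_eq_bot_iff[of "G X"]
      by (simp add: G h_bot abs_B2_eq_bot_iff spine_image_in_ideal_iff)
  qed
  show ?thesis by (rule not_OCA)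
qed

theorem theorem6p1:
  shows "(CH \<longrightarrow> (\<exists>f :: B1 \<Rightarrow> B2. boolean_algebra_iso f)) \<and>
         (OCA \<longrightarrow> \<not> (\<exists>f :: B1 \<Rightarrow> B2. boolean_algebra_iso f))"
  using CH_imp_iso iso_imp_not_OCA by blast

end
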